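(* Let $(R,\mathfrak m)$ be a commutative noetherian local ring, let $I$ be an ideal of $R$ and let $M$ be an $R$-module. Then the following are equivalent: (i) $M^{\circ}$ is $I$-generated. (ii) $M$ is $I^{\circ}$-cogenerated. (iii) There is an $R$-module $C$ with $C/C[I]\cong M$. If moreover $M\cong A/B$ with $A$ a free $R$-module and $B$ a submodule of $A$, then these conditions are also equivalent to (iv) $B=(IB):_A I$.
   Context: $E$ denotes the injective hull of the residue field $R/\mathfrak m$, and for an $R$-module $N$, $N^{\circ}=\operatorname{Hom}_R(N,E)$ is its Matlis dual. An $R$-module $N$ is called $I$-generated if there are an index set $\Lambda$ and an epimorphism $I^{(\Lambda)}\twoheadrightarrow N$, where $I^{(\Lambda)}$ is the direct sum of $\Lambda$ copies of the $R$-module $I$. An $R$-module $N$ is called $I^{\circ}$-cogenerated if there are an index set $\Lambda$ and a monomorphism $N\hookrightarrow (I^{\circ})^{\Lambda}$ into a direct product of copies of $I^{\circ}$. For an $R$-module $C$, $C[I]=\{c\in C\mid Ic=0\}$. For a submodule $W$ of $A$, $W:_A I=\{a\in A\mid Ia\subset W\}$. *)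

theory Defs
  imports "HOL-Algebra.Module" "HOL-Algebra.QuotRing" "HOL-Algebra.Ring_Divisibility"
begin

locale noetherian_local_ring = cring R + noetherian_ring R for R (structure) +
  fixes \<mm>
  assumes maximal: "maximalideal \<mm> R"
    and unique_maximal: "maximalideal J R \<Longrightarrow> J = \<mm>"

text \<open>
  The record type of modules extends that of rings. Its fields for ring multiplication and unit
  do not occur in the axioms of a module, so their values below are irrelevant.
\<close>

definition module_hom ::
    "('r, 'k) ring_scheme \<Rightarrow> ('r, 'a, 'b) module_scheme \<Rightarrow> ('r, 'c, 'd) module_scheme \<Rightarrow> ('a \<Rightarrow> 'c) set"
  where "module_hom R M N =
    {f \<in> carrier M \<rightarrow> carrier N.
       (\<forall>x\<in>carrier M. \<forall>y\<in>carrier M. f (x \<oplus>\<^bsub>M\<^esub> y) = f x \<oplus>\<^bsub>N\<^esub> f y) \<and>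
       (\<forall>r\<in>carrier R. \<forall>x\<in>carrier M. f (r \<odot>\<^bsub>M\<^esub> x) = r \<odot>\<^bsub>N\<^esub> f x)}"

definition module_mono ::
    "('r, 'k) ring_scheme \<Rightarrow> ('r, 'a, 'b) module_scheme \<Rightarrow> ('r, 'c, 'd) module_scheme \<Rightarrow> ('a \<Rightarrow> 'c) set"
  where "module_mono R M N = {f \<in> module_hom R M N. inj_on f (carrier M)}"

definition module_epi ::
    "('r, 'k) ring_scheme \<Rightarrow> ('r, 'a, 'b) module_scheme \<Rightarrow> ('r, 'c, 'd) module_scheme \<Rightarrow> ('a \<Rightarrow> 'c) set"
  where "module_epi R M N = {f \<in> module_hom R M N. f ` carrier M = carrier N}"

definition module_isomorphic ::
    "('r, 'k) ring_scheme \<Rightarrow> ('r, 'a, 'b) module_scheme \<Rightarrow> ('r, 'c, 'd) module_scheme \<Rightarrow> bool"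
  where "module_isomorphic R M N \<longleftrightarrow>
    (\<exists>f \<in> module_hom R M N. bij_betw f (carrier M) (carrier N))"

text \<open>An ideal \<open>I\<close> of \<open>R\<close> (for instance \<open>carrier R\<close>) as an \<open>R\<close>-module.\<close>

definition ideal_module :: "('r, 'k) ring_scheme \<Rightarrow> 'r set \<Rightarrow> ('r, 'r) module"
  where "ideal_module R I =
    \<lparr>carrier = I, mult = (\<otimes>\<^bsub>R\<^esub>), one = \<one>\<^bsub>R\<^esub>, zero = \<zero>\<^bsub>R\<^esub>,
     add = (\<oplus>\<^bsub>R\<^esub>), smult = (\<otimes>\<^bsub>R\<^esub>)\<rparr>"

definition quotient_module :: "('r, 'a, 'b) module_scheme \<Rightarrow> 'a set \<Rightarrow> ('r, 'a set) module"
  where "quotient_module M B =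
    \<lparr>carrier = a_rcosets\<^bsub>M\<^esub> B, mult = undefined, one = undefined,
     zero = B, add = set_add M, smult = (\<lambda>r X. \<Union>x\<in>X. B +>\<^bsub>M\<^esub> (r \<odot>\<^bsub>M\<^esub> x))\<rparr>"

text \<open>
  Homomorphisms are restricted to the carrier (with value \<^const>\<open>undefined\<close> outside), so that
  equality in the \<open>Hom\<close> module is equality of maps.
\<close>

definition Hom_module ::
    "('r, 'k) ring_scheme \<Rightarrow> ('r, 'a, 'b) module_scheme \<Rightarrow> ('r, 'c, 'd) module_scheme
      \<Rightarrow> ('r, 'a \<Rightarrow> 'c) module"
  where "Hom_module R M N =
    \<lparr>carrier = module_hom R M N \<inter> extensional (carrier M), mult = undefined, one = undefined,
     zero = (\<lambda>x\<in>carrier M. \<zero>\<^bsub>N\<^esub>),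
     add = (\<lambda>f g. \<lambda>x\<in>carrier M. f x \<oplus>\<^bsub>N\<^esub> g x),
     smult = (\<lambda>r f. \<lambda>x\<in>carrier M. r \<odot>\<^bsub>N\<^esub> f x)\<rparr>"

definition direct_power :: "'l set \<Rightarrow> ('r, 'a, 'b) module_scheme \<Rightarrow> ('r, 'l \<Rightarrow> 'a) module"
  where "direct_power \<Lambda> N =
    \<lparr>carrier = \<Lambda> \<rightarrow>\<^sub>E carrier N, mult = undefined, one = undefined,
     zero = (\<lambda>l\<in>\<Lambda>. \<zero>\<^bsub>N\<^esub>),
     add = (\<lambda>f g. \<lambda>l\<in>\<Lambda>. f l \<oplus>\<^bsub>N\<^esub> g l),
     smult = (\<lambda>r f. \<lambda>l\<in>\<Lambda>. r \<odot>\<^bsub>N\<^esub> f l)\<rparr>"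

definition direct_sum_copies :: "'l set \<Rightarrow> ('r, 'a, 'b) module_scheme \<Rightarrow> ('r, 'l \<Rightarrow> 'a) module"
  where "direct_sum_copies \<Lambda> N =
    (direct_power \<Lambda> N)\<lparr>carrier := {f \<in> \<Lambda> \<rightarrow>\<^sub>E carrier N. finite {l \<in> \<Lambda>. f l \<noteq> \<zero>\<^bsub>N\<^esub>}}\<rparr>"

text \<open>A module is free if it has a basis \<open>S\<close>: every element is \<open>\<Sum>s\<in>S. c s \<cdot> s\<close> for a unique
  finitely supported coefficient family \<open>c \<in> R\<^sup>(\<^sup>S\<^sup>)\<close>.\<close>

definition is_basis :: "('r, 'k) ring_scheme \<Rightarrow> ('r, 'a, 'b) module_scheme \<Rightarrow> 'a set \<Rightarrow> bool"
  where "is_basis R A S \<longleftrightarrow> S \<subseteq> carrier A \<and>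
    bij_betw (\<lambda>c. \<Oplus>\<^bsub>A\<^esub>s\<in>{s \<in> S. c s \<noteq> \<zero>\<^bsub>R\<^esub>}. c s \<odot>\<^bsub>A\<^esub> s)
      (carrier (direct_sum_copies S (ideal_module R (carrier R)))) (carrier A)"

definition free_module :: "('r, 'k) ring_scheme \<Rightarrow> ('r, 'a, 'b) module_scheme \<Rightarrow> bool"
  where "free_module R A \<longleftrightarrow> module R A \<and> (\<exists>S. is_basis R A S)"

text \<open>
  A formula cannot quantify over types, so the test modules \<open>X\<close> and \<open>Y\<close> have their carriers in
  the type of ring elements. This already includes the inclusions of ideals into \<open>R\<close>, so by
  Baer's criterion it amounts to the extension property for modules over arbitrary types.
\<close>

definition injective_module :: "('r, 'k) ring_scheme \<Rightarrow> ('r, 'e, 'd) module_scheme \<Rightarrow> bool"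
  where "injective_module R E \<longleftrightarrow> module R E \<and>
    (\<forall>(X :: ('r, 'r) module) (Y :: ('r, 'r) module). module R X \<longrightarrow> module R Y \<longrightarrow>
       (\<forall>i \<in> module_mono R X Y. \<forall>g \<in> module_hom R X E.
          \<exists>h \<in> module_hom R Y E. \<forall>x\<in>carrier X. h (i x) = g x))"

definition essential_submodule ::
    "('r, 'k) ring_scheme \<Rightarrow> ('r, 'e, 'd) module_scheme \<Rightarrow> 'e set \<Rightarrow> bool"
  where "essential_submodule R E N \<longleftrightarrow> submodule N R E \<and>
    (\<forall>H. submodule H R E \<longrightarrow> H \<noteq> {\<zero>\<^bsub>E\<^esub>} \<longrightarrow> H \<inter> N \<noteq> {\<zero>\<^bsub>E\<^esub>})"

definition injective_hull ::
    "('r, 'k) ring_scheme \<Rightarrow> ('r, 'a, 'b) module_scheme \<Rightarrow> ('r, 'e, 'd) module_scheme \<Rightarrow> bool"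
  where "injective_hull R N E \<longleftrightarrow> injective_module R E \<and>
    (\<exists>i \<in> module_mono R N E. essential_submodule R E (i ` carrier N))"

definition residue_field :: "('r, 'k) ring_scheme \<Rightarrow> 'r set \<Rightarrow> ('r, 'r set) module"
  where "residue_field R \<mm> = quotient_module (ideal_module R (carrier R)) \<mm>"

definition matlis_dual ::
    "('r, 'k) ring_scheme \<Rightarrow> ('r, 'e, 'd) module_scheme \<Rightarrow> ('r, 'a, 'b) module_scheme
      \<Rightarrow> ('r, 'a \<Rightarrow> 'e) module"
  where "matlis_dual R E N = Hom_module R N E"

definition generated_via ::
    "('r, 'k) ring_scheme \<Rightarrow> ('r, 'p, 'b) module_scheme \<Rightarrow> ('r, 'n, 'd) module_scheme \<Rightarrow> 'l set \<Rightarrow> bool"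
  where "generated_via R P N \<Lambda> \<longleftrightarrow> module_epi R (direct_sum_copies \<Lambda> P) N \<noteq> {}"

definition cogenerated_via ::
    "('r, 'k) ring_scheme \<Rightarrow> ('r, 'p, 'b) module_scheme \<Rightarrow> ('r, 'n, 'd) module_scheme \<Rightarrow> 'l set \<Rightarrow> bool"
  where "cogenerated_via R P N \<Lambda> \<longleftrightarrow> module_mono R N (direct_power \<Lambda> P) \<noteq> {}"

text \<open>
  Existence of an index set is stated for index sets of maps between the two modules. This is no
  restriction: \<open>Hom(P, N)\<close>, respectively \<open>Hom(N, P)\<close>, serves as an index set as soon as an index
  set over any type does.
\<close>

definition generated_by ::
    "('r, 'k) ring_scheme \<Rightarrow> ('r, 'p, 'b) module_scheme \<Rightarrow> ('r, 'n, 'd) module_scheme \<Rightarrow> bool"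
  where "generated_by R P N \<longleftrightarrow> (\<exists>\<Lambda> :: ('p \<Rightarrow> 'n) set. generated_via R P N \<Lambda>)"

definition cogenerated_by ::
    "('r, 'k) ring_scheme \<Rightarrow> ('r, 'p, 'b) module_scheme \<Rightarrow> ('r, 'n, 'd) module_scheme \<Rightarrow> bool"
  where "cogenerated_by R P N \<longleftrightarrow> (\<exists>\<Lambda> :: ('n \<Rightarrow> 'p) set. cogenerated_via R P N \<Lambda>)"

text \<open>The submodule \<open>C[I]\<close> of \<open>C\<close>.\<close>

definition annihilated_part :: "('r, 'c, 'b) module_scheme \<Rightarrow> 'r set \<Rightarrow> 'c set"
  where "annihilated_part C I = {c \<in> carrier C. \<forall>i\<in>I. i \<odot>\<^bsub>C\<^esub> c = \<zero>\<^bsub>C\<^esub>}"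

text \<open>\<open>I B\<close>, for an ideal \<open>I\<close> and a submodule \<open>B\<close> of \<open>A\<close>: the finite sums of products \<open>i b\<close>. As
  both are nonempty, zero need not be added explicitly.\<close>

inductive_set ideal_times :: "('r, 'a, 'b) module_scheme \<Rightarrow> 'r set \<Rightarrow> 'a set \<Rightarrow> 'a set"
  for A and I and B where
    prod: "\<lbrakk>i \<in> I; b \<in> B\<rbrakk> \<Longrightarrow> i \<odot>\<^bsub>A\<^esub> b \<in> ideal_times A I B"
  | sum: "\<lbrakk>x \<in> ideal_times A I B; y \<in> ideal_times A I B\<rbrakk> \<Longrightarrow> x \<oplus>\<^bsub>A\<^esub> y \<in> ideal_times A I B"

definition colon :: "('r, 'a, 'b) module_scheme \<Rightarrow> 'a set \<Rightarrow> 'r set \<Rightarrow> 'a set"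
  where "colon A W I = {a \<in> carrier A. \<forall>i\<in>I. i \<odot>\<^bsub>A\<^esub> a \<in> W}"

end

theory Submission
  imports Defs
begin

text \<open>
  Write \<open>N\<^sup>o\<close> for \<open>Hom(N, E)\<close>. A homomorphism \<open>I \<rightarrow> M\<^sup>o\<close> and a homomorphism \<open>M \<rightarrow> I\<^sup>o\<close> are the same
  thing, namely a bilinear map \<open>\<beta> : I \<times> M \<rightarrow> E\<close>. In these terms, \<open>M\<^sup>o\<close> is \<open>I\<close>-generated if and only
  if every \<open>f : M \<rightarrow> E\<close> is a finite sum of maps \<open>\<beta>(i, -)\<close>, and \<open>M\<close> is \<open>I\<^sup>o\<close>-cogenerated if and only if
  for each \<open>x \<noteq> 0\<close> in \<open>M\<close> some \<open>\<beta>(-, x)\<close> is nonzero; the latter is the form in which condition (ii)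
  enters all other arguments. Two properties of \<open>E\<close> are used: homomorphisms into \<open>E\<close> extend
  along monomorphisms of modules over any type (Baer's criterion, \<open>injective_extension\<close>), and a
  nonzero element of any module is detected by a homomorphism to \<open>E\<close>
  (\<open>residue_field_hull_cogenerates\<close>).

  If \<open>M\<^sup>o\<close> is \<open>I\<close>-generated and all \<open>\<beta>(-, x)\<close> vanish, then all \<open>f : M \<rightarrow> E\<close> vanish at \<open>x\<close>, so \<open>x = 0\<close>
  (\<open>dual_generated_imp_separated\<close>). Conversely, let \<open>I\<close> be generated by the finite set \<open>K\<close>. The
  values \<open>\<beta>(k, x)\<close>, for all \<open>\<beta>\<close> and all \<open>k \<in> K\<close>, embed \<open>M\<close> into a power of \<open>E\<close>. A given \<open>f : M \<rightarrow> E\<close>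
  extends to that power, and splitting the power according to the finitely many \<open>k\<close> writes \<open>f\<close> as a
  sum over \<open>k\<close> of maps \<open>\<beta>\<^sub>k(k, -)\<close> (\<open>separated_imp_dual_generated\<close>).

  If \<open>M \<cong> C/C[I]\<close> and \<open>c \<in> C\<close> represents \<open>x \<noteq> 0\<close>, then \<open>i c \<noteq> 0\<close> for some \<open>i \<in> I\<close>, and \<open>f(i c) \<noteq> 0\<close> for
  some \<open>f : C \<rightarrow> E\<close>; the map \<open>(i, c) \<mapsto> f(i c)\<close> descends to \<open>I \<times> M\<close> and detects \<open>x\<close>
  (\<open>quotient_by_annihilated_part_separated\<close>). If \<open>M \<cong> A/B\<close> with \<open>B = (IB) : I\<close>, then \<open>C = A/IB\<close> has
  \<open>C[I] = B/IB\<close>, so \<open>C/C[I] \<cong> M\<close> (\<open>colon_eq_imp_quotient_by_annihilated_part\<close>).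

  Finally let \<open>A\<close> be free, \<open>M \<cong> A/B\<close> be \<open>I\<^sup>o\<close>-cogenerated and \<open>I a \<subseteq> I B\<close>. Any \<open>\<beta> : I \<times> M \<rightarrow> E\<close> pulls
  back to \<open>I \<times> A\<close>, where it has the form \<open>(i, a) \<mapsto> h(i a)\<close> for some \<open>h : A \<rightarrow> E\<close>: on a basis element
  \<open>s\<close> this is the extension of \<open>\<beta>(-, s) : I \<rightarrow> E\<close> to \<open>R\<close>. As \<open>\<beta>\<close> vanishes on \<open>I \<times> B\<close>, the map \<open>h\<close> vanishes
  on \<open>I B\<close> and hence on \<open>I a\<close>. So no \<open>\<beta>\<close> detects the image of \<open>a\<close> in \<open>M\<close>, which is therefore zero
  (\<open>separated_imp_colon_eq\<close>). Presenting \<open>M\<close> by the free module on its own elements, one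
  obtains a module \<open>C\<close> as in (iii) from (ii).
\<close>

section \<open>Homomorphisms\<close>

lemma module_homI:
  assumes "\<And>x. x \<in> carrier M \<Longrightarrow> f x \<in> carrier N"
    and "\<And>x y. \<lbrakk>x \<in> carrier M; y \<in> carrier M\<rbrakk> \<Longrightarrow> f (x \<oplus>\<^bsub>M\<^esub> y) = f x \<oplus>\<^bsub>N\<^esub> f y"
    and "\<And>r x. \<lbrakk>r \<in> carrier R; x \<in> carrier M\<rbrakk> \<Longrightarrow> f (r \<odot>\<^bsub>M\<^esub> x) = r \<odot>\<^bsub>N\<^esub> f x"
  shows "f \<in> module_hom R M N"
  using assms by (auto simp: module_hom_def)

lemma
  assumes "f \<in> module_hom R M N"
  shows module_hom_closed: "x \<in> carrier M \<Longrightarrow> f x \<in> carrier N"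
    and module_hom_add: "\<lbrakk>x \<in> carrier M; y \<in> carrier M\<rbrakk> \<Longrightarrow> f (x \<oplus>\<^bsub>M\<^esub> y) = f x \<oplus>\<^bsub>N\<^esub> f y"
    and module_hom_smult: "\<lbrakk>r \<in> carrier R; x \<in> carrier M\<rbrakk> \<Longrightarrow> f (r \<odot>\<^bsub>M\<^esub> x) = r \<odot>\<^bsub>N\<^esub> f x"
  using assms by (auto simp: module_hom_def)

lemma module_hom_zero:
  assumes "module R M" "module R N" "f \<in> module_hom R M N"
  shows "f \<zero>\<^bsub>M\<^esub> = \<zero>\<^bsub>N\<^esub>"
proof -
  interpret M: module R M by fact
  interpret N: module R N by fact
  have "f \<zero>\<^bsub>M\<^esub> = f (\<zero>\<^bsub>R\<^esub> \<odot>\<^bsub>M\<^esub> \<zero>\<^bsub>M\<^esub>)" by simp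
  also have "\<dots> = \<zero>\<^bsub>R\<^esub> \<odot>\<^bsub>N\<^esub> f \<zero>\<^bsub>M\<^esub>"
    by (rule module_hom_smult[OF assms(3)]) auto
  finally show ?thesis using module_hom_closed[OF assms(3)] by simp
qed

lemma module_hom_minus:
  assumes "module R M" "module R N" "f \<in> module_hom R M N" "x \<in> carrier M"
  shows "f (\<ominus>\<^bsub>M\<^esub> x) = \<ominus>\<^bsub>N\<^esub> f x"
proof -
  interpret M: module R M by fact
  interpret N: module R N by fact
  have "f (\<ominus>\<^bsub>M\<^esub> x) \<oplus>\<^bsub>N\<^esub> f x = f (\<ominus>\<^bsub>M\<^esub> x \<oplus>\<^bsub>M\<^esub> x)"
    using module_hom_add[OF assms(3)] assms(4) by simp
  also have "\<dots> = \<zero>\<^bsub>N\<^esub>" using module_hom_zero[OF assms(1-3)] assms(4) by (simp add: M.M.l_neg)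
  finally show ?thesis using module_hom_closed[OF assms(3)] assms(4) N.M.minus_equality by simp
qed

lemma module_hom_comp:
  assumes "f \<in> module_hom R L M" "g \<in> module_hom R M N"
  shows "(\<lambda>x. g (f x)) \<in> module_hom R L N"
  using assms by (auto simp: module_hom_def Pi_iff)

lemma module_hom_diff_eq_zero:
  assumes "module R M" "module R N" "f \<in> module_hom R M N" "x \<in> carrier M" "y \<in> carrier M"
    and "f x = f y"
  shows "f (x \<oplus>\<^bsub>M\<^esub> \<ominus>\<^bsub>M\<^esub> y) = \<zero>\<^bsub>N\<^esub>"
proof -
  interpret M: module R M by fact
  interpret N: module R N by fact
  show ?thesis using assms module_hom_closed[OF assms(3)]
    by (simp add: module_hom_add[OF assms(3)] module_hom_minus N.M.r_neg)
qed

lemma (in module) diff_eq_zeroD: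
  assumes "x \<in> carrier M" "y \<in> carrier M" "x \<oplus>\<^bsub>M\<^esub> \<ominus>\<^bsub>M\<^esub> y = \<zero>\<^bsub>M\<^esub>"
  shows "x = y"
  using assms M.minus_equality[of x "\<ominus>\<^bsub>M\<^esub> y"] by simp

lemma module_hom_injI:
  assumes "module R M" "module R N" "f \<in> module_hom R M N"
    and "\<And>x. \<lbrakk>x \<in> carrier M; f x = \<zero>\<^bsub>N\<^esub>\<rbrakk> \<Longrightarrow> x = \<zero>\<^bsub>M\<^esub>"
  shows "inj_on f (carrier M)"
proof (rule inj_onI)
  interpret M: module R M by fact
  fix x y assume xy: "x \<in> carrier M" "y \<in> carrier M" "f x = f y"
  then have "x \<oplus>\<^bsub>M\<^esub> \<ominus>\<^bsub>M\<^esub> y = \<zero>\<^bsub>M\<^esub>"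
    using module_hom_diff_eq_zero[OF assms(1-3) xy] assms(4) by simp
  then show "x = y" using M.diff_eq_zeroD xy by blast
qed

lemma module_hom_inverse:
  assumes "module R M" "module R N" "f \<in> module_hom R M N" "bij_betw f (carrier M) (carrier N)"
  shows "inv_into (carrier M) f \<in> module_hom R N M"
proof (rule module_homI)
  interpret M: module R M by fact
  interpret N: module R N by fact
  let ?g = "inv_into (carrier M) f"
  have inj: "inj_on f (carrier M)" and im: "f ` carrier M = carrier N"
    using assms(4) by (auto simp: bij_betw_def)
  have gc: "?g y \<in> carrier M" if "y \<in> carrier N" for y
    using that im inv_into_into by metis
  have fg: "f (?g y) = y" if "y \<in> carrier N" for y
    using that im f_inv_into_f by metis
  show "?g y \<in> carrier M" if "y \<in> carrier N" for y by (rule gc) fact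
  show "?g (x \<oplus>\<^bsub>N\<^esub> y) = ?g x \<oplus>\<^bsub>M\<^esub> ?g y" if "x \<in> carrier N" "y \<in> carrier N" for x y
    by (rule inv_into_f_eq[OF inj]) (use that gc fg module_hom_add[OF assms(3)] in auto)
  show "?g (r \<odot>\<^bsub>N\<^esub> y) = r \<odot>\<^bsub>M\<^esub> ?g y" if "r \<in> carrier R" "y \<in> carrier N" for r y
    by (rule inv_into_f_eq[OF inj]) (use that gc fg module_hom_smult[OF assms(3)] in auto)
qed

lemma factor_through_epi:
  assumes "module R A" "module R M" "module R N"
    and p: "p \<in> module_epi R A M" and \<phi>: "\<phi> \<in> module_hom R A N"
    and ker: "\<And>a. \<lbrakk>a \<in> carrier A; p a = \<zero>\<^bsub>M\<^esub>\<rbrakk> \<Longrightarrow> \<phi> a = \<zero>\<^bsub>N\<^esub>"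
  obtains \<psi> where "\<psi> \<in> module_hom R M N" "\<And>a. a \<in> carrier A \<Longrightarrow> \<psi> (p a) = \<phi> a"
proof
  interpret A: module R A by fact
  interpret M: module R M by fact
  interpret N: module R N by fact
  have ph: "p \<in> module_hom R A M" and im: "p ` carrier A = carrier M"
    using p by (auto simp: module_epi_def)
  let ?\<psi> = "\<lambda>m. \<phi> (inv_into (carrier A) p m)"
  have eq: "\<phi> a = \<phi> b" if "a \<in> carrier A" "b \<in> carrier A" "p a = p b" for a b
  proof -
    have "\<phi> a \<oplus>\<^bsub>N\<^esub> \<ominus>\<^bsub>N\<^esub> \<phi> b = \<phi> (a \<oplus>\<^bsub>A\<^esub> \<ominus>\<^bsub>A\<^esub> b)"
      using that assms by (simp add: module_hom_add[OF \<phi>] module_hom_minus)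
    also have "\<dots> = \<zero>\<^bsub>N\<^esub>"
      using ker module_hom_diff_eq_zero[OF assms(1,2) ph that] that by simp
    finally show ?thesis using N.diff_eq_zeroD that module_hom_closed[OF \<phi>] by blast
  qed
  show *: "?\<psi> (p a) = \<phi> a" if "a \<in> carrier A" for a
    by (rule eq) (use that in \<open>auto intro: inv_into_into f_inv_into_f\<close>)
  show "?\<psi> \<in> module_hom R M N"
  proof (rule module_homI)
    fix x assume "x \<in> carrier M"
    then obtain a where a: "a \<in> carrier A" "x = p a" using im by blast
    then show "?\<psi> x \<in> carrier N" using * module_hom_closed[OF \<phi>] by simp
    fix r assume "r \<in> carrier R"
    then show "?\<psi> (r \<odot>\<^bsub>M\<^esub> x) = r \<odot>\<^bsub>N\<^esub> ?\<psi> x"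
      using a * *[of "r \<odot>\<^bsub>A\<^esub> a"] module_hom_smult[OF \<phi>] module_hom_smult[OF ph] by simp
  next
    fix x y assume "x \<in> carrier M" "y \<in> carrier M"
    then obtain a b where "a \<in> carrier A" "x = p a" "b \<in> carrier A" "y = p b" using im by blast
    then show "?\<psi> (x \<oplus>\<^bsub>M\<^esub> y) = ?\<psi> x \<oplus>\<^bsub>N\<^esub> ?\<psi> y"
      using * *[of "a \<oplus>\<^bsub>A\<^esub> b"] module_hom_add[OF \<phi>] module_hom_add[OF ph] by simp
  qed
qed

lemma kernel_submodule:
  assumes "module R M" "module R N" "f \<in> module_hom R M N"
  shows "submodule {x \<in> carrier M. f x = \<zero>\<^bsub>N\<^esub>} R M"
proof -
  interpret M: module R M by fact
  interpret N: module R N by fact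
  show ?thesis
    by (rule M.submoduleI)
      (use assms(3) in \<open>auto simp: module_hom_zero[OF assms] module_hom_minus[OF assms]
        module_hom_add module_hom_smult\<close>)
qed

section \<open>Ideals as modules\<close>

lemma ideal_module_simps [simp]:
  "carrier (ideal_module R J) = J"
  "add (ideal_module R J) = add R"
  "zero (ideal_module R J) = zero R"
  "smult (ideal_module R J) = mult R"
  by (simp_all add: ideal_module_def)

lemma idealI_cring:
  assumes "cring R" "J \<subseteq> carrier R" "\<zero>\<^bsub>R\<^esub> \<in> J"
    and "\<And>x y. \<lbrakk>x \<in> J; y \<in> J\<rbrakk> \<Longrightarrow> x \<oplus>\<^bsub>R\<^esub> y \<in> J"
    and "\<And>r x. \<lbrakk>r \<in> carrier R; x \<in> J\<rbrakk> \<Longrightarrow> r \<otimes>\<^bsub>R\<^esub> x \<in> J"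
  shows "ideal J R"
proof -
  interpret cring R by fact
  have "\<ominus>\<^bsub>R\<^esub> x \<in> J" if "x \<in> J" for x
    using assms(5)[of "\<ominus>\<^bsub>R\<^esub> \<one>\<^bsub>R\<^esub>" x] that assms(2) by (auto simp: l_minus)
  moreover have "x \<otimes>\<^bsub>R\<^esub> r \<in> J" if "r \<in> carrier R" "x \<in> J" for r x
    using assms(5)[OF that] m_comm[of x r] that assms(2) by auto
  ultimately show ?thesis
    using assms by (intro idealI ring_axioms add.subgroupI) (auto simp: a_inv_def)
qed

lemma module_ideal_module:
  assumes "cring R" "ideal J R"
  shows "module R (ideal_module R J)"
proof -
  interpret cring R by fact
  interpret J: ideal J R by fact
  note [simp] = J.I_l_closed
  show ?thesis
  proof (rule moduleI)
    show "abelian_group (ideal_module R J)"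
    proof (rule abelian_groupI)
      fix x assume "x \<in> carrier (ideal_module R J)"
      then show "\<exists>y\<in>carrier (ideal_module R J). y \<oplus>\<^bsub>ideal_module R J\<^esub> x = \<zero>\<^bsub>ideal_module R J\<^esub>"
        by (intro bexI[of _ "\<ominus>\<^bsub>R\<^esub> x"]) (simp_all add: l_neg J.Icarr)
    qed (simp_all add: a_ac J.Icarr)
  qed (simp_all add: l_distr r_distr m_assoc J.Icarr is_cring)
qed

text \<open>
  The zeros of \<open>g\<close> form an ideal that contains \<open>K\<close>.
\<close>

lemma ideal_hom_determined_by_generators:
  assumes "K \<subseteq> carrier R" "module R E"
    and g: "g \<in> module_hom R (ideal_module R (genideal R K)) E" "\<And>k. k \<in> K \<Longrightarrow> g k = \<zero>\<^bsub>E\<^esub>"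
    and x: "x \<in> genideal R K"
  shows "g x = \<zero>\<^bsub>E\<^esub>"
proof -
  interpret E: module R E by fact
  interpret J: ideal "genideal R K" R by (rule E.R.genideal_ideal[OF assms(1)])
  have I: "module R (ideal_module R (genideal R K))"
    by (rule module_ideal_module[OF E.R.is_cring J.ideal_axioms])
  let ?Z = "{x \<in> genideal R K. g x = \<zero>\<^bsub>E\<^esub>}"
  have "ideal ?Z R"
  proof (rule idealI_cring[OF E.R.is_cring])
    show "?Z \<subseteq> carrier R" using J.Icarr by blast
    show "\<zero>\<^bsub>R\<^esub> \<in> ?Z" using module_hom_zero[OF I assms(2) g(1)] by simp
    show "a \<oplus>\<^bsub>R\<^esub> b \<in> ?Z" if "a \<in> ?Z" "b \<in> ?Z" for a b
      using module_hom_add[OF g(1), of a b] that by simp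
    show "r \<otimes>\<^bsub>R\<^esub> a \<in> ?Z" if "r \<in> carrier R" "a \<in> ?Z" for r a
      using module_hom_smult[OF g(1), of r a] that J.I_l_closed by simp
  qed
  moreover have "K \<subseteq> ?Z" using E.R.genideal_self[OF assms(1)] g(2) by blast
  ultimately have "genideal R K \<subseteq> ?Z" by (rule E.R.genideal_minimal)
  then show ?thesis using x by blast
qed

section \<open>Quotient modules\<close>

text \<open>
  Module axioms pass along a surjection that respects the operations. Applied to the projection onto
  cosets, this spares a verification of each axiom on cosets.
\<close>

lemma module_of_surjection:
  assumes "module R A" and surj: "p ` carrier A = carrier Q" and zero: "p \<zero>\<^bsub>A\<^esub> = \<zero>\<^bsub>Q\<^esub>"
    and add: "\<And>x y. \<lbrakk>x \<in> carrier A; y \<in> carrier A\<rbrakk> \<Longrightarrow> p x \<oplus>\<^bsub>Q\<^esub> p y = p (x \<oplus>\<^bsub>A\<^esub> y)"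
    and smult: "\<And>r x. \<lbrakk>r \<in> carrier R; x \<in> carrier A\<rbrakk> \<Longrightarrow> r \<odot>\<^bsub>Q\<^esub> p x = p (r \<odot>\<^bsub>A\<^esub> x)"
  shows "module R Q"
proof -
  interpret A: module R A by fact
  have repr: thesis if "x \<in> carrier Q" "\<And>a. \<lbrakk>a \<in> carrier A; x = p a\<rbrakk> \<Longrightarrow> thesis" for x thesis
    using that surj by blast
  have pc: "p x \<in> carrier Q" if "x \<in> carrier A" for x using that surj by blast
  note [simp] = zero[symmetric] add smult
  show ?thesis
  proof (rule moduleI)
    show "abelian_group Q"
    proof (rule abelian_groupI)
      fix x assume "x \<in> carrier Q"
      then obtain a where a: "a \<in> carrier A" "x = p a" using surj by blast
      then show "\<exists>y\<in>carrier Q. y \<oplus>\<^bsub>Q\<^esub> x = \<zero>\<^bsub>Q\<^esub>"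
        by (intro bexI[of _ "p (\<ominus>\<^bsub>A\<^esub> a)"] pc) (simp_all add: A.M.l_neg)
    qed (auto elim!: repr simp: pc A.M.a_ac)
  qed (auto elim!: repr simp: pc A.R.is_cring A.smult_l_distr A.smult_r_distr A.smult_assoc1)
qed

lemma
  assumes "module R A" "submodule D R A"
  shows module_quotient_module: "module R (quotient_module A D)"
    and quotient_proj_epi: "(\<lambda>a. D +>\<^bsub>A\<^esub> a) \<in> module_epi R A (quotient_module A D)"
    and quotient_proj_eq_zero_iff:
      "a \<in> carrier A \<Longrightarrow> D +>\<^bsub>A\<^esub> a = \<zero>\<^bsub>quotient_module A D\<^esub> \<longleftrightarrow> a \<in> D"
proof -
  interpret A: module R A by fact
  interpret S: submodule D R A by fact
  interpret D: abelian_subgroup D A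
    by (rule abelian_subgroupI3[OF additive_subgroup.intro A.M.abelian_group_axioms]) (rule S.subgroup_axioms)
  let ?Q = "quotient_module A D"
  let ?p = "\<lambda>a. D +>\<^bsub>A\<^esub> a"
  have Q: "carrier ?Q = a_rcosets\<^bsub>A\<^esub> D" "add ?Q = set_add A" "zero ?Q = D"
    "smult ?Q = (\<lambda>r X. \<Union>x\<in>X. D +>\<^bsub>A\<^esub> (r \<odot>\<^bsub>A\<^esub> x))"
    by (simp_all add: quotient_module_def)
  have surj: "?p ` carrier A = carrier ?Q" by (auto simp: Q A_RCOSETS_def')
  have zero: "?p \<zero>\<^bsub>A\<^esub> = \<zero>\<^bsub>?Q\<^esub>" using D.a_subset by (simp add: Q)
  have add: "?p x \<oplus>\<^bsub>?Q\<^esub> ?p y = ?p (x \<oplus>\<^bsub>A\<^esub> y)" if "x \<in> carrier A" "y \<in> carrier A" for x y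
    using D.a_rcos_sum[OF that] by (simp add: Q)
  have smult: "r \<odot>\<^bsub>?Q\<^esub> ?p x = ?p (r \<odot>\<^bsub>A\<^esub> x)" if r: "r \<in> carrier R" and x: "x \<in> carrier A" for r x
  proof -
    have eq: "?p (r \<odot>\<^bsub>A\<^esub> y) = ?p (r \<odot>\<^bsub>A\<^esub> x)" if y: "y \<in> ?p x" for y
    proof -
      have yA: "y \<in> carrier A" using D.a_elemrcos_carrier[OF x y] .
      have "y \<oplus>\<^bsub>A\<^esub> \<ominus>\<^bsub>A\<^esub> x \<in> D" by (rule D.a_rcos_module_imp[OF x y])
      then have "r \<odot>\<^bsub>A\<^esub> (y \<oplus>\<^bsub>A\<^esub> \<ominus>\<^bsub>A\<^esub> x) \<in> D" using r by blast
      then have "r \<odot>\<^bsub>A\<^esub> y \<in> ?p (r \<odot>\<^bsub>A\<^esub> x)"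
        using D.a_rcos_module_rev[of "r \<odot>\<^bsub>A\<^esub> x" "r \<odot>\<^bsub>A\<^esub> y"] r x yA
        by (simp add: A.smult_r_distr A.smult_r_minus)
      then show ?thesis using D.a_repr_independence'[of _ "r \<odot>\<^bsub>A\<^esub> x"] r x by simp
    qed
    have "?p x \<noteq> {}" using D.a_rcos_self[OF x] by (metis empty_iff)
    then have "(\<Union>y\<in>?p x. ?p (r \<odot>\<^bsub>A\<^esub> y)) = ?p (r \<odot>\<^bsub>A\<^esub> x)"
      by (subst SUP_cong[OF refl eq]) simp_all
    then show ?thesis by (simp add: Q)
  qed
  show "module R ?Q" by (rule module_of_surjection[OF \<open>module R A\<close> surj zero add smult])
  show "?p \<in> module_epi R A ?Q"
    unfolding module_epi_def
    by (auto intro!: module_homI simp: surj add smult simp flip: surj)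
  show "?p a = \<zero>\<^bsub>?Q\<^esub> \<longleftrightarrow> a \<in> D" if "a \<in> carrier A"
    using D.a_rcos_const D.a_rcos_self[OF that] by (auto simp: Q)
qed

section \<open>Extending homomorphisms into an injective module\<close>

text \<open>
  A homomorphism from an ideal \<open>J\<close> to \<open>E\<close> extends to \<open>R\<close>, and the value of the extension at \<open>1\<close> is
  the required \<open>e\<close>.
\<close>

lemma injective_module_ideal:
  assumes "injective_module R E" "ideal J R" "\<phi> \<in> module_hom R (ideal_module R J) E"
  obtains e where "e \<in> carrier E" "\<And>r. r \<in> J \<Longrightarrow> \<phi> r = r \<odot>\<^bsub>E\<^esub> e"
proof -
  interpret E: module R E using assms(1) by (simp add: injective_module_def)
  interpret J: ideal J R by fact
  have "cring R" by (rule E.R.is_cring)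
  then have "module R (ideal_module R J)" "module R (ideal_module R (carrier R))"
    using assms(2) E.R.oneideal by (auto intro: module_ideal_module)
  moreover have "(\<lambda>x. x) \<in> module_mono R (ideal_module R J) (ideal_module R (carrier R))"
    by (auto simp: module_mono_def module_hom_def J.Icarr)
  ultimately obtain h where h: "h \<in> module_hom R (ideal_module R (carrier R)) E"
    "\<And>x. x \<in> J \<Longrightarrow> h x = \<phi> x"
    using assms(1,3) unfolding injective_module_def by (metis ideal_module_simps(1))
  show ?thesis
  proof
    show "h \<one>\<^bsub>R\<^esub> \<in> carrier E" using module_hom_closed[OF h(1)] by simp
    show "\<phi> r = r \<odot>\<^bsub>E\<^esub> h \<one>\<^bsub>R\<^esub>" if "r \<in> J" for r
      using module_hom_smult[OF h(1), of r "\<one>\<^bsub>R\<^esub>"] h(2)[OF that] J.Icarr[OF that] by simp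
  qed
qed

text \<open>
  The graph of a homomorphism from a submodule of \<open>Y\<close> to \<open>E\<close>, as a set of pairs: a submodule of
  \<open>Y \<times> E\<close> that meets \<open>0 \<times> E\<close> only in zero. With graphs, extension of a partial homomorphism is
  inclusion and the union of a chain is its supremum, which is what Zorn's lemma asks for.
\<close>

definition linear_graph ::
    "('r, 'k) ring_scheme \<Rightarrow> ('r, 'a, 'b) module_scheme \<Rightarrow> ('r, 'c, 'd) module_scheme
      \<Rightarrow> ('a \<times> 'c) set \<Rightarrow> bool"
  where "linear_graph R Y E G \<longleftrightarrow> G \<subseteq> carrier Y \<times> carrier E \<and> (\<zero>\<^bsub>Y\<^esub>, \<zero>\<^bsub>E\<^esub>) \<in> G \<and>
    (\<forall>(y, e) \<in> G. \<forall>(y', e') \<in> G. (y \<oplus>\<^bsub>Y\<^esub> y', e \<oplus>\<^bsub>E\<^esub> e') \<in> G) \<and>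
    (\<forall>r \<in> carrier R. \<forall>(y, e) \<in> G. (r \<odot>\<^bsub>Y\<^esub> y, r \<odot>\<^bsub>E\<^esub> e) \<in> G) \<and>
    (\<forall>e. (\<zero>\<^bsub>Y\<^esub>, e) \<in> G \<longrightarrow> e = \<zero>\<^bsub>E\<^esub>)"

lemma linear_graphI:
  assumes "G \<subseteq> carrier Y \<times> carrier E" "(\<zero>\<^bsub>Y\<^esub>, \<zero>\<^bsub>E\<^esub>) \<in> G"
    and "\<And>y e y' e'. \<lbrakk>(y, e) \<in> G; (y', e') \<in> G\<rbrakk> \<Longrightarrow> (y \<oplus>\<^bsub>Y\<^esub> y', e \<oplus>\<^bsub>E\<^esub> e') \<in> G"
    and "\<And>r y e. \<lbrakk>r \<in> carrier R; (y, e) \<in> G\<rbrakk> \<Longrightarrow> (r \<odot>\<^bsub>Y\<^esub> y, r \<odot>\<^bsub>E\<^esub> e) \<in> G"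
    and "\<And>e. (\<zero>\<^bsub>Y\<^esub>, e) \<in> G \<Longrightarrow> e = \<zero>\<^bsub>E\<^esub>"
  shows "linear_graph R Y E G"
  using assms unfolding linear_graph_def by blast

lemma
  assumes "linear_graph R Y E G"
  shows linear_graph_carrier: "(y, e) \<in> G \<Longrightarrow> y \<in> carrier Y \<and> e \<in> carrier E"
    and linear_graph_zero: "(\<zero>\<^bsub>Y\<^esub>, \<zero>\<^bsub>E\<^esub>) \<in> G"
    and linear_graph_add: "\<lbrakk>(y, e) \<in> G; (y', e') \<in> G\<rbrakk> \<Longrightarrow> (y \<oplus>\<^bsub>Y\<^esub> y', e \<oplus>\<^bsub>E\<^esub> e') \<in> G"
    and linear_graph_smult: "\<lbrakk>r \<in> carrier R; (y, e) \<in> G\<rbrakk> \<Longrightarrow> (r \<odot>\<^bsub>Y\<^esub> y, r \<odot>\<^bsub>E\<^esub> e) \<in> G"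
    and linear_graph_zeroD: "(\<zero>\<^bsub>Y\<^esub>, e) \<in> G \<Longrightarrow> e = \<zero>\<^bsub>E\<^esub>"
  using assms unfolding linear_graph_def by blast+

lemma linear_graph_minus:
  assumes "module R Y" "module R E" "linear_graph R Y E G" "(y, e) \<in> G"
  shows "(\<ominus>\<^bsub>Y\<^esub> y, \<ominus>\<^bsub>E\<^esub> e) \<in> G"
proof -
  interpret Y: module R Y by fact
  interpret E: module R E by fact
  have "(\<ominus>\<^bsub>R\<^esub> \<one>\<^bsub>R\<^esub> \<odot>\<^bsub>Y\<^esub> y, \<ominus>\<^bsub>R\<^esub> \<one>\<^bsub>R\<^esub> \<odot>\<^bsub>E\<^esub> e) \<in> G"
    by (rule linear_graph_smult[OF assms(3) _ assms(4)]) simp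
  then show ?thesis
    using linear_graph_carrier[OF assms(3,4)] by (simp add: Y.smult_l_minus E.smult_l_minus)
qed

lemma linear_graph_unique:
  assumes "module R Y" "module R E" "linear_graph R Y E G" "(y, e) \<in> G" "(y, e') \<in> G"
  shows "e = e'"
proof -
  interpret Y: module R Y by fact
  interpret E: module R E by fact
  have "(y \<oplus>\<^bsub>Y\<^esub> \<ominus>\<^bsub>Y\<^esub> y, e \<oplus>\<^bsub>E\<^esub> \<ominus>\<^bsub>E\<^esub> e') \<in> G"
    by (rule linear_graph_add[OF assms(3,4)]) (rule linear_graph_minus[OF assms(1-3,5)])
  then have "e \<oplus>\<^bsub>E\<^esub> \<ominus>\<^bsub>E\<^esub> e' = \<zero>\<^bsub>E\<^esub>"
    using linear_graph_zeroD[OF assms(3)] linear_graph_carrier[OF assms(3,4)]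
    by (simp add: Y.M.r_neg)
  then show ?thesis
    using E.diff_eq_zeroD linear_graph_carrier[OF assms(3)] assms(4,5) by blast
qed

text \<open>
  The one-element step of Baer's criterion. The ring elements \<open>r\<close> for which \<open>r y\<close> already lies in the
  domain form an ideal \<open>J\<close>, and \<open>J \<rightarrow> E\<close>, sending \<open>r\<close> to the value at \<open>r y\<close>, is multiplication by
  some \<open>e\<^sub>0 \<in> E\<close>. Declaring \<open>e\<^sub>0\<close> to be the value at \<open>y\<close> is then consistent.
\<close>

lemma linear_graph_extend_by_element:
  assumes inj: "injective_module R E" and "module R Y" and G: "linear_graph R Y E G"
    and y: "y \<in> carrier Y"
  obtains G' e where "linear_graph R Y E G'" "G \<subseteq> G'" "(y, e) \<in> G'"
proof -
  interpret E: module R E using inj by (simp add: injective_module_def)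
  interpret Y: module R Y by fact
  note Gc = linear_graph_carrier[OF G]
  note uniq = linear_graph_unique[OF \<open>module R Y\<close> E.module_axioms G]
  define J where "J = {r \<in> carrier R. \<exists>e. (r \<odot>\<^bsub>Y\<^esub> y, e) \<in> G}"
  define \<phi> where "\<phi> r = (THE e. (r \<odot>\<^bsub>Y\<^esub> y, e) \<in> G)" for r
  have \<phi>_eq: "\<phi> r = e" if "(r \<odot>\<^bsub>Y\<^esub> y, e) \<in> G" for r e
    unfolding \<phi>_def using that uniq by (intro the_equality) auto
  have J: "ideal J R"
  proof (rule idealI_cring)
    show "cring R" by (rule E.R.is_cring)
    show "J \<subseteq> carrier R" by (auto simp: J_def)
    show "\<zero>\<^bsub>R\<^esub> \<in> J" using y linear_graph_zero[OF G] by (auto simp: J_def)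
    show "a \<oplus>\<^bsub>R\<^esub> b \<in> J" if "a \<in> J" "b \<in> J" for a b
      using that y unfolding J_def by (auto simp: Y.smult_l_distr dest: linear_graph_add[OF G])
    show "r \<otimes>\<^bsub>R\<^esub> a \<in> J" if "r \<in> carrier R" "a \<in> J" for r a
      using that y unfolding J_def by (auto simp: Y.smult_assoc1 dest: linear_graph_smult[OF G])
  qed
  have "\<phi> \<in> module_hom R (ideal_module R J) E"
  proof (rule module_homI, simp_all)
    fix a assume a: "a \<in> J"
    then obtain e where e: "(a \<odot>\<^bsub>Y\<^esub> y, e) \<in> G" and aR: "a \<in> carrier R" by (auto simp: J_def)
    show "\<phi> a \<in> carrier E" using \<phi>_eq[OF e] Gc[OF e] by simp
    show "\<phi> (r \<otimes>\<^bsub>R\<^esub> a) = r \<odot>\<^bsub>E\<^esub> \<phi> a" if "r \<in> carrier R" for r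
      using linear_graph_smult[OF G that e] \<phi>_eq[OF e] y that aR
      by (intro \<phi>_eq) (simp add: Y.smult_assoc1)
    fix b assume "b \<in> J"
    then obtain e' where e': "(b \<odot>\<^bsub>Y\<^esub> y, e') \<in> G" and bR: "b \<in> carrier R" by (auto simp: J_def)
    show "\<phi> (a \<oplus>\<^bsub>R\<^esub> b) = \<phi> a \<oplus>\<^bsub>E\<^esub> \<phi> b"
      using linear_graph_add[OF G e e'] \<phi>_eq[OF e] \<phi>_eq[OF e'] y aR bR
      by (intro \<phi>_eq) (simp add: Y.smult_l_distr)
  qed
  then obtain e0 where e0: "e0 \<in> carrier E" "\<And>r. r \<in> J \<Longrightarrow> \<phi> r = r \<odot>\<^bsub>E\<^esub> e0"
    using injective_module_ideal[OF inj J] by blast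
  define G' where "G' = {(d \<oplus>\<^bsub>Y\<^esub> r \<odot>\<^bsub>Y\<^esub> y, v \<oplus>\<^bsub>E\<^esub> r \<odot>\<^bsub>E\<^esub> e0) | d v r. (d, v) \<in> G \<and> r \<in> carrier R}"
  have G'I: "(x, w) \<in> G'"
    if "(d, v) \<in> G" "r \<in> carrier R" "x = d \<oplus>\<^bsub>Y\<^esub> r \<odot>\<^bsub>Y\<^esub> y" "w = v \<oplus>\<^bsub>E\<^esub> r \<odot>\<^bsub>E\<^esub> e0" for d v r x w
    using that unfolding G'_def by blast
  have "linear_graph R Y E G'"
  proof (rule linear_graphI)
    show "G' \<subseteq> carrier Y \<times> carrier E" using Gc y e0(1) by (auto simp: G'_def)
    show "(\<zero>\<^bsub>Y\<^esub>, \<zero>\<^bsub>E\<^esub>) \<in> G'"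
      by (rule G'I[OF linear_graph_zero[OF G], of "\<zero>\<^bsub>R\<^esub>"]) (use y e0(1) in auto)
  next
    fix x w x' w' assume "(x, w) \<in> G'" "(x', w') \<in> G'"
    then obtain d v r d' v' r' where *: "(d, v) \<in> G" "r \<in> carrier R" "x = d \<oplus>\<^bsub>Y\<^esub> r \<odot>\<^bsub>Y\<^esub> y"
      "w = v \<oplus>\<^bsub>E\<^esub> r \<odot>\<^bsub>E\<^esub> e0" "(d', v') \<in> G" "r' \<in> carrier R" "x' = d' \<oplus>\<^bsub>Y\<^esub> r' \<odot>\<^bsub>Y\<^esub> y"
      "w' = v' \<oplus>\<^bsub>E\<^esub> r' \<odot>\<^bsub>E\<^esub> e0"
      unfolding G'_def by blast
    show "(x \<oplus>\<^bsub>Y\<^esub> x', w \<oplus>\<^bsub>E\<^esub> w') \<in> G'"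
      by (rule G'I[OF linear_graph_add[OF G *(1,5)], of "r \<oplus>\<^bsub>R\<^esub> r'"])
        (use * Gc[OF *(1)] Gc[OF *(5)] y e0(1) in
          \<open>auto simp: Y.smult_l_distr E.smult_l_distr Y.M.a_ac E.M.a_ac\<close>)
  next
    fix s x w assume s: "s \<in> carrier R" and "(x, w) \<in> G'"
    then obtain d v r where *: "(d, v) \<in> G" "r \<in> carrier R" "x = d \<oplus>\<^bsub>Y\<^esub> r \<odot>\<^bsub>Y\<^esub> y"
      "w = v \<oplus>\<^bsub>E\<^esub> r \<odot>\<^bsub>E\<^esub> e0"
      unfolding G'_def by blast
    show "(s \<odot>\<^bsub>Y\<^esub> x, s \<odot>\<^bsub>E\<^esub> w) \<in> G'"
      by (rule G'I[OF linear_graph_smult[OF G s *(1)], of "s \<otimes>\<^bsub>R\<^esub> r"])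
        (use s * Gc[OF *(1)] y e0(1) in
          \<open>auto simp: Y.smult_r_distr E.smult_r_distr Y.smult_assoc1 E.smult_assoc1\<close>)
  next
    fix w assume "(\<zero>\<^bsub>Y\<^esub>, w) \<in> G'"
    then obtain d v r where *: "(d, v) \<in> G" "r \<in> carrier R" "\<zero>\<^bsub>Y\<^esub> = d \<oplus>\<^bsub>Y\<^esub> r \<odot>\<^bsub>Y\<^esub> y"
      "w = v \<oplus>\<^bsub>E\<^esub> r \<odot>\<^bsub>E\<^esub> e0"
      unfolding G'_def by blast
    \<comment> \<open>Here \<open>r y = - d\<close> lies in the old domain, so \<open>r \<in> J\<close> and \<open>r e\<^sub>0\<close> must be the old value \<open>- v\<close>.\<close>
    have "r \<odot>\<^bsub>Y\<^esub> y = \<ominus>\<^bsub>Y\<^esub> d"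
      using * Gc[OF *(1)] y Y.M.minus_equality[of "r \<odot>\<^bsub>Y\<^esub> y" d] by (simp add: Y.M.a_comm)
    then have ry: "(r \<odot>\<^bsub>Y\<^esub> y, \<ominus>\<^bsub>E\<^esub> v) \<in> G"
      using linear_graph_minus[OF \<open>module R Y\<close> E.module_axioms G *(1)] by simp
    then have "r \<in> J" using * by (auto simp: J_def)
    then have "r \<odot>\<^bsub>E\<^esub> e0 = \<ominus>\<^bsub>E\<^esub> v" using e0(2) \<phi>_eq[OF ry] by simp
    then show "w = \<zero>\<^bsub>E\<^esub>" using * Gc[OF *(1)] by (simp add: E.M.r_neg)
  qed
  moreover have "G \<subseteq> G'"
  proof safe
    fix d v assume "(d, v) \<in> G"
    then show "(d, v) \<in> G'"
      by (rule G'I[of d v "\<zero>\<^bsub>R\<^esub>"]) (use Gc[OF \<open>(d, v) \<in> G\<close>] y e0(1) in auto)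
  qed
  moreover have "(y, e0) \<in> G'"
    by (rule G'I[OF linear_graph_zero[OF G], of "\<one>\<^bsub>R\<^esub>"]) (use y e0(1) in auto)
  ultimately show ?thesis by (rule that)
qed

lemma linear_graph_Union:
  assumes "\<C> \<noteq> {}" "subset.chain {G. linear_graph R Y E G} \<C>"
  shows "linear_graph R Y E (\<Union>\<C>)"
proof (rule linear_graphI)
  have lg: "linear_graph R Y E G" if "G \<in> \<C>" for G
    using assms(2) that by (auto simp: subset.chain_def)
  obtain G0 where G0: "G0 \<in> \<C>" using assms(1) by blast
  show "\<Union>\<C> \<subseteq> carrier Y \<times> carrier E" using linear_graph_carrier[OF lg] by fastforce
  show "(\<zero>\<^bsub>Y\<^esub>, \<zero>\<^bsub>E\<^esub>) \<in> \<Union>\<C>" using linear_graph_zero[OF lg[OF G0]] G0 by blast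
  show "(y \<oplus>\<^bsub>Y\<^esub> y', e \<oplus>\<^bsub>E\<^esub> e') \<in> \<Union>\<C>" if mem: "(y, e) \<in> \<Union>\<C>" "(y', e') \<in> \<Union>\<C>" for y e y' e'
  proof -
    obtain G1 G2 where G12: "G1 \<in> \<C>" "(y, e) \<in> G1" "G2 \<in> \<C>" "(y', e') \<in> G2" using mem by blast
    then have "G1 \<subseteq> G2 \<or> G2 \<subseteq> G1" using assms(2) by (auto simp: subset_chain_def)
    then obtain G where "G \<in> \<C>" "(y, e) \<in> G" "(y', e') \<in> G" using G12 by blast
    then show ?thesis using linear_graph_add[OF lg] by blast
  qed
  show "(r \<odot>\<^bsub>Y\<^esub> y, r \<odot>\<^bsub>E\<^esub> e) \<in> \<Union>\<C>" if "r \<in> carrier R" "(y, e) \<in> \<Union>\<C>" for r y e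
    using that linear_graph_smult[OF lg] by blast
  show "e = \<zero>\<^bsub>E\<^esub>" if "(\<zero>\<^bsub>Y\<^esub>, e) \<in> \<Union>\<C>" for e
    using that linear_graph_zeroD[OF lg] by blast
qed

lemma linear_graph_extension:
  assumes inj: "injective_module R E" and "module R Y" and G: "linear_graph R Y E G"
  obtains h where "h \<in> module_hom R Y E" "\<And>y e. (y, e) \<in> G \<Longrightarrow> h y = e"
proof -
  interpret E: module R E using inj by (simp add: injective_module_def)
  interpret Y: module R Y by fact
  have "\<exists>H \<in> {H. linear_graph R Y E H \<and> G \<subseteq> H}. \<forall>X \<in> {H. linear_graph R Y E H \<and> G \<subseteq> H}.
      H \<subseteq> X \<longrightarrow> X = H"
  proof (rule subset_Zorn_nonempty)
    show "{H. linear_graph R Y E H \<and> G \<subseteq> H} \<noteq> {}" using G by blast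
    fix \<C> assume C: "\<C> \<noteq> {}" "subset.chain {H. linear_graph R Y E H \<and> G \<subseteq> H} \<C>"
    then have "subset.chain {H. linear_graph R Y E H} \<C>" by (auto simp: subset_chain_def)
    then have "linear_graph R Y E (\<Union>\<C>)" using linear_graph_Union C(1) by blast
    moreover obtain H where "H \<in> \<C>" using C(1) by blast
    with C(2) have "G \<subseteq> \<Union>\<C>" by (auto simp: subset_chain_def)
    ultimately show "\<Union>\<C> \<in> {H. linear_graph R Y E H \<and> G \<subseteq> H}" by blast
  qed
  then obtain H where H: "linear_graph R Y E H" "G \<subseteq> H"
    and max: "\<And>X. \<lbrakk>linear_graph R Y E X; H \<subseteq> X\<rbrakk> \<Longrightarrow> X = H" by auto
  have total: "\<exists>e. (y, e) \<in> H" if "y \<in> carrier Y" for y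
    using linear_graph_extend_by_element[OF inj \<open>module R Y\<close> H(1) that] max by metis
  define h where "h y = (THE e. (y, e) \<in> H)" for y
  have h_eq: "h y = e" if "(y, e) \<in> H" for y e
    unfolding h_def using that linear_graph_unique[OF \<open>module R Y\<close> E.module_axioms H(1)]
    by (intro the_equality) auto
  have hH: "(y, h y) \<in> H" if "y \<in> carrier Y" for y using total[OF that] h_eq by auto
  show ?thesis
  proof
    show "h \<in> module_hom R Y E"
    proof (rule module_homI)
      show "h y \<in> carrier E" if "y \<in> carrier Y" for y
        using linear_graph_carrier[OF H(1) hH[OF that]] by simp
      show "h (y \<oplus>\<^bsub>Y\<^esub> y') = h y \<oplus>\<^bsub>E\<^esub> h y'" if "y \<in> carrier Y" "y' \<in> carrier Y" for y y'
        by (rule h_eq[OF linear_graph_add[OF H(1) hH[OF that(1)] hH[OF that(2)]]])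
      show "h (r \<odot>\<^bsub>Y\<^esub> y) = r \<odot>\<^bsub>E\<^esub> h y" if "r \<in> carrier R" "y \<in> carrier Y" for r y
        by (rule h_eq[OF linear_graph_smult[OF H(1) that(1) hH[OF that(2)]]])
    qed
    show "h y = e" if "(y, e) \<in> G" for y e using that H(2) h_eq by blast
  qed
qed

lemma injective_extension:
  assumes inj: "injective_module R E" and "module R X" "module R Y"
    and i: "i \<in> module_mono R X Y" and f: "f \<in> module_hom R X E"
  obtains h where "h \<in> module_hom R Y E" "\<And>x. x \<in> carrier X \<Longrightarrow> h (i x) = f x"
proof -
  interpret E: module R E using inj by (simp add: injective_module_def)
  interpret X: module R X by fact
  interpret Y: module R Y by fact
  have ih: "i \<in> module_hom R X Y" and iinj: "inj_on i (carrier X)"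
    using i by (auto simp: module_mono_def)
  let ?G = "{(i x, f x) | x. x \<in> carrier X}"
  have "linear_graph R Y E ?G"
  proof (rule linear_graphI)
    show "?G \<subseteq> carrier Y \<times> carrier E" using module_hom_closed[OF ih] module_hom_closed[OF f] by auto
    show "(\<zero>\<^bsub>Y\<^esub>, \<zero>\<^bsub>E\<^esub>) \<in> ?G"
      using module_hom_zero[OF X.module_axioms Y.module_axioms ih]
        module_hom_zero[OF X.module_axioms E.module_axioms f] X.M.zero_closed by force
    show "(y \<oplus>\<^bsub>Y\<^esub> y', e \<oplus>\<^bsub>E\<^esub> e') \<in> ?G" if "(y, e) \<in> ?G" "(y', e') \<in> ?G" for y e y' e'
      using that by (auto simp flip: module_hom_add[OF ih] module_hom_add[OF f])
    show "(r \<odot>\<^bsub>Y\<^esub> y, r \<odot>\<^bsub>E\<^esub> e) \<in> ?G" if "r \<in> carrier R" "(y, e) \<in> ?G" for r y e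
      using that by (auto simp flip: module_hom_smult[OF ih] module_hom_smult[OF f])
    show "e = \<zero>\<^bsub>E\<^esub>" if graph: "(\<zero>\<^bsub>Y\<^esub>, e) \<in> ?G" for e
    proof -
      obtain x where x: "x \<in> carrier X" "i x = \<zero>\<^bsub>Y\<^esub>" "e = f x" using graph by auto
      then have "x = \<zero>\<^bsub>X\<^esub>"
        using module_hom_zero[OF X.module_axioms Y.module_axioms ih] inj_onD[OF iinj] by simp
      then show ?thesis using x module_hom_zero[OF X.module_axioms E.module_axioms f] by simp
    qed
  qed
  from linear_graph_extension[OF inj \<open>module R Y\<close> this] obtain h
    where "h \<in> module_hom R Y E" "\<And>y e. (y, e) \<in> ?G \<Longrightarrow> h y = e" by blast
  then show ?thesis using that by blast
qed

section \<open>The injective hull of the residue field as a cogenerator\<close>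

lemma (in noetherian_ring) proper_ideal_in_maximalideal:
  assumes "ideal J R" "J \<noteq> carrier R"
  obtains P where "maximalideal P R" "J \<subseteq> P"
proof -
  let ?S = "{P. ideal P R \<and> J \<subseteq> P \<and> P \<noteq> carrier R}"
  have "\<exists>P \<in> ?S. \<forall>X \<in> ?S. P \<subseteq> X \<longrightarrow> X = P"
  proof (rule subset_Zorn_nonempty)
    show "?S \<noteq> {}" using assms by blast
    fix \<C> assume C: "\<C> \<noteq> {}" "subset.chain ?S \<C>"
    then have "subset.chain {P. ideal P R} \<C>" by (auto simp: subset_chain_def)
    then have "\<Union>\<C> \<in> \<C>" using ideal_chain_is_trivial C(1) by blast
    then show "\<Union>\<C> \<in> ?S" using C(2) by (auto simp: subset_chain_def)
  qed
  then obtain P where "P \<in> ?S" and max: "\<forall>X \<in> ?S. P \<subseteq> X \<longrightarrow> X = P" by (rule bexE)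
  then have P: "ideal P R" "J \<subseteq> P" "P \<noteq> carrier R" by simp_all
  have "maximalideal P R"
  proof (rule maximalidealI[OF P(1)])
    show "carrier R \<noteq> P" using P(3) by simp
    show "X = P \<or> X = carrier R" if "ideal X R" "P \<subseteq> X" for X
      using max that P(2) by auto
  qed
  then show ?thesis using that P by blast
qed

text \<open>
  The annihilator of \<open>x\<close> is a proper ideal and so lies in \<open>\<mm>\<close>. Hence \<open>r x \<mapsto> r + \<mm>\<close> is a well defined
  homomorphism from the cyclic submodule of \<open>x\<close> to the residue field that is nonzero at \<open>x\<close>. It is
  embedded into \<open>E\<close> and then extended to \<open>M\<close>.
\<close>

lemma residue_field_hull_cogenerates:
  assumes "noetherian_local_ring R \<mm>" and hull: "injective_hull R (residue_field R \<mm>) E"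
    and "module R M" and x: "x \<in> carrier M" "x \<noteq> \<zero>\<^bsub>M\<^esub>"
  obtains f where "f \<in> module_hom R M E" "f x \<noteq> \<zero>\<^bsub>E\<^esub>"
proof -
  interpret R: noetherian_local_ring R \<mm> by fact
  interpret \<mm>: maximalideal \<mm> R by (rule R.maximal)
  interpret M: module R M by fact
  have inj: "injective_module R E" using hull by (simp add: injective_hull_def)
  then interpret E: module R E by (simp add: injective_module_def)
  let ?F = "ideal_module R (carrier R)"
  let ?K = "residue_field R \<mm>"
  let ?k = "\<lambda>r. \<mm> +>\<^bsub>?F\<^esub> r"
  interpret F: module R ?F by (rule module_ideal_module[OF R.is_cring R.oneideal])
  have "submodule \<mm> R ?F"
  proof (rule F.submoduleI)
    show "\<ominus>\<^bsub>?F\<^esub> a \<in> \<mm>" if "a \<in> \<mm>" for a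
    proof -
      have "\<ominus>\<^bsub>?F\<^esub> a = \<ominus>\<^bsub>R\<^esub> a" by (simp add: a_inv_def m_inv_def)
      then show ?thesis using that by simp
    qed
  qed (auto simp: \<mm>.Icarr \<mm>.I_l_closed)
  note K = module_quotient_module[OF F.module_axioms this, folded residue_field_def]
    quotient_proj_epi[OF F.module_axioms this, folded residue_field_def]
    quotient_proj_eq_zero_iff[OF F.module_axioms this, folded residue_field_def]
  interpret K: module R ?K by (rule K(1))
  have k: "?k \<in> module_hom R ?F ?K" using K(2) by (simp add: module_epi_def)
  obtain i where i: "i \<in> module_hom R ?K E" "inj_on i (carrier ?K)"
    using hull by (auto simp: injective_hull_def module_mono_def)
  note ik = module_hom_comp[OF k i(1)]
  have ik_zero: "i (?k r) = \<zero>\<^bsub>E\<^esub> \<longleftrightarrow> r \<in> \<mm>" if "r \<in> carrier R" for r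
  proof -
    have "i (?k r) = \<zero>\<^bsub>E\<^esub> \<longleftrightarrow> i (?k r) = i \<zero>\<^bsub>?K\<^esub>"
      using module_hom_zero[OF K.module_axioms E.module_axioms i(1)] by simp
    also have "\<dots> \<longleftrightarrow> ?k r = \<zero>\<^bsub>?K\<^esub>"
      using inj_on_eq_iff[OF i(2), of "?k r" "\<zero>\<^bsub>?K\<^esub>"] module_hom_closed[OF k, of r] that by simp
    finally show ?thesis using K(3) that by simp
  qed
  let ?J = "{r \<in> carrier R. r \<odot>\<^bsub>M\<^esub> x = \<zero>\<^bsub>M\<^esub>}"
  have "ideal ?J R"
    by (rule idealI_cring[OF R.is_cring])
      (use x(1) in \<open>auto simp: M.smult_l_distr M.smult_assoc1\<close>)
  moreover have "?J \<noteq> carrier R" using x by (metis (lifting) M.smult_one R.one_closed mem_Collect_eq)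
  ultimately have J: "?J \<subseteq> \<mm>"
    using R.proper_ideal_in_maximalideal R.unique_maximal by metis
  let ?G = "{(r \<odot>\<^bsub>M\<^esub> x, i (?k r)) | r. r \<in> carrier R}"
  have "linear_graph R M E ?G"
  proof (rule linear_graphI)
    show "?G \<subseteq> carrier M \<times> carrier E" using x(1) module_hom_closed[OF ik] by auto
    have "\<zero>\<^bsub>R\<^esub> \<odot>\<^bsub>M\<^esub> x = \<zero>\<^bsub>M\<^esub>" "i (?k \<zero>\<^bsub>R\<^esub>) = \<zero>\<^bsub>E\<^esub>" using x(1) ik_zero by auto
    then show "(\<zero>\<^bsub>M\<^esub>, \<zero>\<^bsub>E\<^esub>) \<in> ?G" by (metis (mono_tags, lifting) R.zero_closed mem_Collect_eq)
  next
    fix y e y' e' assume "(y, e) \<in> ?G" "(y', e') \<in> ?G"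
    then obtain r s where "r \<in> carrier R" "s \<in> carrier R"
      "y = r \<odot>\<^bsub>M\<^esub> x" "e = i (?k r)" "y' = s \<odot>\<^bsub>M\<^esub> x" "e' = i (?k s)" by blast
    moreover from this have "i (?k (r \<oplus>\<^bsub>R\<^esub> s)) = e \<oplus>\<^bsub>E\<^esub> e'" using module_hom_add[OF ik] by simp
    ultimately show "(y \<oplus>\<^bsub>M\<^esub> y', e \<oplus>\<^bsub>E\<^esub> e') \<in> ?G"
      using x(1) by (auto intro!: exI[of _ "r \<oplus>\<^bsub>R\<^esub> s"] simp: M.smult_l_distr)
  next
    fix s y e assume s: "s \<in> carrier R" and "(y, e) \<in> ?G"
    then obtain r where "r \<in> carrier R" "y = r \<odot>\<^bsub>M\<^esub> x" "e = i (?k r)" by blast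
    moreover from this have "i (?k (s \<otimes>\<^bsub>R\<^esub> r)) = s \<odot>\<^bsub>E\<^esub> e" using module_hom_smult[OF ik] s by simp
    ultimately show "(s \<odot>\<^bsub>M\<^esub> y, s \<odot>\<^bsub>E\<^esub> e) \<in> ?G"
      using x(1) s by (auto intro!: exI[of _ "s \<otimes>\<^bsub>R\<^esub> r"] simp: M.smult_assoc1)
  next
    fix e assume "(\<zero>\<^bsub>M\<^esub>, e) \<in> ?G"
    then show "e = \<zero>\<^bsub>E\<^esub>" using J ik_zero by auto
  qed
  from linear_graph_extension[OF inj \<open>module R M\<close> this] obtain f
    where f: "f \<in> module_hom R M E" "\<And>y e. (y, e) \<in> ?G \<Longrightarrow> f y = e" by blast
  have "(x, i (?k \<one>\<^bsub>R\<^esub>)) \<in> ?G" using x(1) by (auto intro!: exI[of _ "\<one>\<^bsub>R\<^esub>"])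
  then have "f x = i (?k \<one>\<^bsub>R\<^esub>)" by (rule f(2))
  moreover have "\<one>\<^bsub>R\<^esub> \<notin> \<mm>" using \<mm>.one_imp_carrier \<mm>.I_notcarr by blast
  ultimately show ?thesis using that[OF f(1)] ik_zero by simp
qed

section \<open>Modules of homomorphisms\<close>

lemma Hom_module_simps [simp]:
  "carrier (Hom_module R M N) = module_hom R M N \<inter> extensional (carrier M)"
  "zero (Hom_module R M N) = (\<lambda>x\<in>carrier M. \<zero>\<^bsub>N\<^esub>)"
  "add (Hom_module R M N) = (\<lambda>f g. \<lambda>x\<in>carrier M. f x \<oplus>\<^bsub>N\<^esub> g x)"
  "smult (Hom_module R M N) = (\<lambda>r f. \<lambda>x\<in>carrier M. r \<odot>\<^bsub>N\<^esub> f x)"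
  by (simp_all add: Hom_module_def)

lemma
  assumes "module R M" "module R N"
  shows module_hom_const_zero: "(\<lambda>x. \<zero>\<^bsub>N\<^esub>) \<in> module_hom R M N"
    and module_hom_pointwise_add: "\<lbrakk>f \<in> module_hom R M N; g \<in> module_hom R M N\<rbrakk>
      \<Longrightarrow> (\<lambda>x. f x \<oplus>\<^bsub>N\<^esub> g x) \<in> module_hom R M N"
    and module_hom_pointwise_smult: "\<lbrakk>r \<in> carrier R; f \<in> module_hom R M N\<rbrakk>
      \<Longrightarrow> (\<lambda>x. r \<odot>\<^bsub>N\<^esub> f x) \<in> module_hom R M N"
    and restrict_module_hom: "f \<in> module_hom R M N
      \<Longrightarrow> (\<lambda>x\<in>carrier M. f x) \<in> carrier (Hom_module R M N)"
proof -
  interpret M: module R M by fact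
  interpret N: module R N by fact
  show "(\<lambda>x. \<zero>\<^bsub>N\<^esub>) \<in> module_hom R M N" by (rule module_homI) auto
  show "(\<lambda>x. f x \<oplus>\<^bsub>N\<^esub> g x) \<in> module_hom R M N"
    if "f \<in> module_hom R M N" "g \<in> module_hom R M N"
    by (rule module_homI) (use that in \<open>auto simp: module_hom_closed module_hom_add
      module_hom_smult N.smult_r_distr N.M.a_ac\<close>)
  show "(\<lambda>x. r \<odot>\<^bsub>N\<^esub> f x) \<in> module_hom R M N" if r: "r \<in> carrier R" and f: "f \<in> module_hom R M N"
  proof (rule module_homI)
    show "r \<odot>\<^bsub>N\<^esub> f (s \<odot>\<^bsub>M\<^esub> x) = s \<odot>\<^bsub>N\<^esub> (r \<odot>\<^bsub>N\<^esub> f x)" if "s \<in> carrier R" "x \<in> carrier M" for s x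
      using that r f by (simp add: module_hom_smult module_hom_closed M.R.m_comm flip: N.smult_assoc1)
  qed (use r f in \<open>auto simp: module_hom_closed module_hom_add N.smult_r_distr\<close>)
  show "(\<lambda>x\<in>carrier M. f x) \<in> carrier (Hom_module R M N)" if "f \<in> module_hom R M N"
    using that by (auto intro!: module_homI simp: module_hom_closed module_hom_add module_hom_smult)
qed

lemma module_Hom_module:
  assumes "module R M" "module R N"
  shows "module R (Hom_module R M N)"
proof -
  interpret M: module R M by fact
  interpret N: module R N by fact
  let ?H = "Hom_module R M N"
  have c: "f \<in> module_hom R M N" "f \<in> extensional (carrier M)" if "f \<in> carrier ?H" for f
    using that by simp_all
  note v [simp] = module_hom_closed[OF c(1)]
  show ?thesis
  proof (rule moduleI)
    show "cring R" by (rule M.R.is_cring)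
    show "abelian_group ?H"
    proof (rule abelian_groupI)
      fix f g h assume f: "f \<in> carrier ?H" and g: "g \<in> carrier ?H" and h: "h \<in> carrier ?H"
      show "f \<oplus>\<^bsub>?H\<^esub> g \<in> carrier ?H"
        using restrict_module_hom[OF assms module_hom_pointwise_add[OF assms c(1)[OF f] c(1)[OF g]]]
        by simp
      show "(f \<oplus>\<^bsub>?H\<^esub> g) \<oplus>\<^bsub>?H\<^esub> h = f \<oplus>\<^bsub>?H\<^esub> (g \<oplus>\<^bsub>?H\<^esub> h)"
        using v[OF f] v[OF g] v[OF h] by (auto simp: fun_eq_iff N.M.a_assoc)
      show "f \<oplus>\<^bsub>?H\<^esub> g = g \<oplus>\<^bsub>?H\<^esub> f"
        using v[OF f] v[OF g] by (auto simp: fun_eq_iff N.M.a_comm)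
      show "\<zero>\<^bsub>?H\<^esub> \<oplus>\<^bsub>?H\<^esub> f = f"
        by (rule extensionalityI[OF _ c(2)[OF f]]) (use v[OF f] in auto)
      let ?n = "\<lambda>x\<in>carrier M. \<ominus>\<^bsub>R\<^esub> \<one>\<^bsub>R\<^esub> \<odot>\<^bsub>N\<^esub> f x"
      have "?n \<in> carrier ?H"
        by (rule restrict_module_hom[OF assms module_hom_pointwise_smult[OF assms _ c(1)[OF f]]]) simp
      moreover have "?n \<oplus>\<^bsub>?H\<^esub> f = \<zero>\<^bsub>?H\<^esub>"
        using v[OF f] by (auto simp: fun_eq_iff N.smult_l_minus N.M.l_neg)
      ultimately show "\<exists>n\<in>carrier ?H. n \<oplus>\<^bsub>?H\<^esub> f = \<zero>\<^bsub>?H\<^esub>" by blast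
    next
      show "\<zero>\<^bsub>?H\<^esub> \<in> carrier ?H"
        using restrict_module_hom[OF assms module_hom_const_zero[OF assms]] by simp
    qed
  next
    fix r s f g assume r: "r \<in> carrier R" and s: "s \<in> carrier R"
      and f: "f \<in> carrier ?H" and g: "g \<in> carrier ?H"
    show "r \<odot>\<^bsub>?H\<^esub> f \<in> carrier ?H"
      using restrict_module_hom[OF assms module_hom_pointwise_smult[OF assms r c(1)[OF f]]] by simp
    show "(r \<oplus>\<^bsub>R\<^esub> s) \<odot>\<^bsub>?H\<^esub> f = r \<odot>\<^bsub>?H\<^esub> f \<oplus>\<^bsub>?H\<^esub> s \<odot>\<^bsub>?H\<^esub> f"
      using v[OF f] r s by (auto simp: fun_eq_iff N.smult_l_distr)
    show "r \<odot>\<^bsub>?H\<^esub> (f \<oplus>\<^bsub>?H\<^esub> g) = r \<odot>\<^bsub>?H\<^esub> f \<oplus>\<^bsub>?H\<^esub> r \<odot>\<^bsub>?H\<^esub> g"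
      using v[OF f] v[OF g] r by (auto simp: fun_eq_iff N.smult_r_distr)
    show "(r \<otimes>\<^bsub>R\<^esub> s) \<odot>\<^bsub>?H\<^esub> f = r \<odot>\<^bsub>?H\<^esub> (s \<odot>\<^bsub>?H\<^esub> f)"
      using v[OF f] r s by (auto simp: fun_eq_iff N.smult_assoc1)
  next
    fix f assume f: "f \<in> carrier ?H"
    show "\<one>\<^bsub>R\<^esub> \<odot>\<^bsub>?H\<^esub> f = f"
      by (rule extensionalityI[OF _ c(2)[OF f]]) (use v[OF f] in auto)
  qed
qed

text \<open>
  A bilinear map \<open>\<beta> : M \<times> N \<rightarrow> E\<close>, given as linear in each argument, is a homomorphism from \<open>M\<close> to
  \<open>Hom(N, E)\<close>. In this form the maps \<open>M \<rightarrow> I\<^sup>o\<close> below are constructed.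
\<close>

lemma module_hom_into_Hom:
  assumes "module R M" "module R N" "module R E"
    and "\<And>m. m \<in> carrier M \<Longrightarrow> \<beta> m \<in> module_hom R N E"
    and "\<And>n. n \<in> carrier N \<Longrightarrow> (\<lambda>m. \<beta> m n) \<in> module_hom R M E"
  shows "(\<lambda>m. \<lambda>n\<in>carrier N. \<beta> m n) \<in> module_hom R M (Hom_module R N E)"
proof (rule module_homI)
  show "(\<lambda>n\<in>carrier N. \<beta> m n) \<in> carrier (Hom_module R N E)" if "m \<in> carrier M" for m
    by (rule restrict_module_hom[OF assms(2,3,4)]) fact
qed (auto simp: fun_eq_iff module_hom_add[OF assms(5)] module_hom_smult[OF assms(5)])

lemma
  assumes "\<phi> \<in> module_hom R M (Hom_module R N E)"
  shows Hom_valued_apply: "m \<in> carrier M \<Longrightarrow> \<phi> m \<in> module_hom R N E"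
    and Hom_valued_extensional: "m \<in> carrier M \<Longrightarrow> \<phi> m \<in> extensional (carrier N)"
    and Hom_valued_eval: "n \<in> carrier N \<Longrightarrow> (\<lambda>m. \<phi> m n) \<in> module_hom R M E"
proof -
  show *: "\<phi> m \<in> module_hom R N E" "\<phi> m \<in> extensional (carrier N)" if "m \<in> carrier M" for m
    using module_hom_closed[OF assms that] by simp_all
  show "(\<lambda>m. \<phi> m n) \<in> module_hom R M E" if n: "n \<in> carrier N"
  proof (rule module_homI)
    show "\<phi> m n \<in> carrier E" if "m \<in> carrier M" for m
      by (rule module_hom_closed[OF *(1)[OF that] n])
  qed (use n in \<open>simp_all add: module_hom_add[OF assms] module_hom_smult[OF assms]\<close>)
qed

lemma Hom_swap:
  assumes "module R M" "module R N" "module R E" "\<phi> \<in> module_hom R M (Hom_module R N E)"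
  shows "(\<lambda>n. \<lambda>m\<in>carrier M. \<phi> m n) \<in> module_hom R N (Hom_module R M E)"
proof (rule module_hom_into_Hom[OF assms(2,1,3)])
  show "(\<lambda>m. \<phi> m n) \<in> module_hom R M E" if "n \<in> carrier N" for n
    by (rule Hom_valued_eval[OF assms(4) that])
  show "(\<lambda>n. \<phi> m n) \<in> module_hom R N E" if "m \<in> carrier M" for m
    using Hom_valued_apply[OF assms(4) that] by simp
qed

section \<open>Direct powers and direct sums\<close>

lemma direct_power_simps [simp]:
  "carrier (direct_power \<Lambda> N) = \<Lambda> \<rightarrow>\<^sub>E carrier N"
  "zero (direct_power \<Lambda> N) = (\<lambda>l\<in>\<Lambda>. \<zero>\<^bsub>N\<^esub>)"
  "add (direct_power \<Lambda> N) = (\<lambda>f g. \<lambda>l\<in>\<Lambda>. f l \<oplus>\<^bsub>N\<^esub> g l)"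
  "smult (direct_power \<Lambda> N) = (\<lambda>r f. \<lambda>l\<in>\<Lambda>. r \<odot>\<^bsub>N\<^esub> f l)"
  by (simp_all add: direct_power_def)

lemma direct_sum_copies_simps [simp]:
  "carrier (direct_sum_copies \<Lambda> N) = {f \<in> \<Lambda> \<rightarrow>\<^sub>E carrier N. finite {l \<in> \<Lambda>. f l \<noteq> \<zero>\<^bsub>N\<^esub>}}"
  "zero (direct_sum_copies \<Lambda> N) = (\<lambda>l\<in>\<Lambda>. \<zero>\<^bsub>N\<^esub>)"
  "add (direct_sum_copies \<Lambda> N) = (\<lambda>f g. \<lambda>l\<in>\<Lambda>. f l \<oplus>\<^bsub>N\<^esub> g l)"
  "smult (direct_sum_copies \<Lambda> N) = (\<lambda>r f. \<lambda>l\<in>\<Lambda>. r \<odot>\<^bsub>N\<^esub> f l)"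
  by (simp_all add: direct_sum_copies_def)

lemma module_direct_power:
  assumes "module R N"
  shows "module R (direct_power \<Lambda> N)"
proof -
  interpret N: module R N by fact
  let ?P = "direct_power \<Lambda> N"
  have v: "f l \<in> carrier N" if "f \<in> carrier ?P" "l \<in> \<Lambda>" for f l using that by auto
  have c: "f \<in> extensional \<Lambda>" if "f \<in> carrier ?P" for f using that by (simp add: PiE_def)
  show ?thesis
  proof (rule moduleI)
    show "cring R" by (rule N.R.is_cring)
    show "abelian_group ?P"
    proof (rule abelian_groupI)
      fix f g h assume f: "f \<in> carrier ?P" and g: "g \<in> carrier ?P" and h: "h \<in> carrier ?P"
      show "f \<oplus>\<^bsub>?P\<^esub> g \<in> carrier ?P" using v[OF f] v[OF g] by auto
      show "(f \<oplus>\<^bsub>?P\<^esub> g) \<oplus>\<^bsub>?P\<^esub> h = f \<oplus>\<^bsub>?P\<^esub> (g \<oplus>\<^bsub>?P\<^esub> h)"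
        using v[OF f] v[OF g] v[OF h] by (auto simp: fun_eq_iff N.M.a_assoc)
      show "f \<oplus>\<^bsub>?P\<^esub> g = g \<oplus>\<^bsub>?P\<^esub> f"
        using v[OF f] v[OF g] by (auto simp: fun_eq_iff N.M.a_comm)
      show "\<zero>\<^bsub>?P\<^esub> \<oplus>\<^bsub>?P\<^esub> f = f"
        by (rule extensionalityI[OF _ c[OF f]]) (use v[OF f] in auto)
      show "\<exists>n\<in>carrier ?P. n \<oplus>\<^bsub>?P\<^esub> f = \<zero>\<^bsub>?P\<^esub>"
        using v[OF f] by (intro bexI[of _ "\<lambda>l\<in>\<Lambda>. \<ominus>\<^bsub>N\<^esub> f l"]) (auto simp: fun_eq_iff N.M.l_neg)
    qed auto
  next
    fix r s f g assume r: "r \<in> carrier R" and s: "s \<in> carrier R"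
      and f: "f \<in> carrier ?P" and g: "g \<in> carrier ?P"
    show "r \<odot>\<^bsub>?P\<^esub> f \<in> carrier ?P" using v[OF f] r by auto
    show "(r \<oplus>\<^bsub>R\<^esub> s) \<odot>\<^bsub>?P\<^esub> f = r \<odot>\<^bsub>?P\<^esub> f \<oplus>\<^bsub>?P\<^esub> s \<odot>\<^bsub>?P\<^esub> f"
      using v[OF f] r s by (auto simp: fun_eq_iff N.smult_l_distr)
    show "r \<odot>\<^bsub>?P\<^esub> (f \<oplus>\<^bsub>?P\<^esub> g) = r \<odot>\<^bsub>?P\<^esub> f \<oplus>\<^bsub>?P\<^esub> r \<odot>\<^bsub>?P\<^esub> g"
      using v[OF f] v[OF g] r by (auto simp: fun_eq_iff N.smult_r_distr)
    show "(r \<otimes>\<^bsub>R\<^esub> s) \<odot>\<^bsub>?P\<^esub> f = r \<odot>\<^bsub>?P\<^esub> (s \<odot>\<^bsub>?P\<^esub> f)"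
      using v[OF f] r s by (auto simp: fun_eq_iff N.smult_assoc1)
  next
    fix f assume f: "f \<in> carrier ?P"
    show "\<one>\<^bsub>R\<^esub> \<odot>\<^bsub>?P\<^esub> f = f"
      by (rule extensionalityI[OF _ c[OF f]]) (use v[OF f] in auto)
  qed
qed

lemma direct_power_component:
  assumes "l \<in> \<Lambda>"
  shows "(\<lambda>f. f l) \<in> module_hom R (direct_power \<Lambda> N) N"
  using assms by (auto intro!: module_homI)

lemma module_hom_into_direct_power:
  assumes "\<And>l. l \<in> \<Lambda> \<Longrightarrow> h l \<in> module_hom R M N"
  shows "(\<lambda>x. \<lambda>l\<in>\<Lambda>. h l x) \<in> module_hom R M (direct_power \<Lambda> N)"
  by (rule module_homI)
    (auto simp: fun_eq_iff module_hom_closed[OF assms] module_hom_add[OF assms] module_hom_smult[OF assms])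

lemma module_direct_sum_copies:
  assumes "module R N"
  shows "module R (direct_sum_copies \<Lambda> N)"
proof -
  interpret N: module R N by fact
  interpret P: module R "direct_power \<Lambda> N" by (rule module_direct_power[OF assms])
  let ?S = "carrier (direct_sum_copies \<Lambda> N)"
  have smult: "r \<odot>\<^bsub>direct_power \<Lambda> N\<^esub> f \<in> ?S" if "r \<in> carrier R" "f \<in> ?S" for r f
    using that by (auto elim!: rev_finite_subset)
  have "submodule ?S R (direct_power \<Lambda> N)"
  proof (rule P.submoduleI)
    show "f \<oplus>\<^bsub>direct_power \<Lambda> N\<^esub> g \<in> ?S" if "f \<in> ?S" "g \<in> ?S" for f g
    proof -
      have "finite ({l \<in> \<Lambda>. f l \<noteq> \<zero>\<^bsub>N\<^esub>} \<union> {l \<in> \<Lambda>. g l \<noteq> \<zero>\<^bsub>N\<^esub>})" using that by simp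
      then have "finite {l \<in> \<Lambda>. f l \<oplus>\<^bsub>N\<^esub> g l \<noteq> \<zero>\<^bsub>N\<^esub>}" by (rule rev_finite_subset) auto
      then show ?thesis using that by (auto cong: conj_cong)
    qed
    show "\<ominus>\<^bsub>direct_power \<Lambda> N\<^esub> f \<in> ?S" if "f \<in> ?S" for f
    proof -
      have "\<ominus>\<^bsub>R\<^esub> \<one>\<^bsub>R\<^esub> \<odot>\<^bsub>direct_power \<Lambda> N\<^esub> f = \<ominus>\<^bsub>direct_power \<Lambda> N\<^esub> f"
        using P.smult_l_minus[of "\<one>\<^bsub>R\<^esub>" f] P.smult_one[of f] that by simp
      then show ?thesis using smult[of "\<ominus>\<^bsub>R\<^esub> \<one>\<^bsub>R\<^esub>" f] that by simp
    qed
  qed (use smult in \<open>auto cong: conj_cong\<close>)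
  from submodule.submodule_is_module[OF this P.module_axioms] show ?thesis
    by (simp add: direct_sum_copies_def)
qed

definition sum_injection ::
    "'l set \<Rightarrow> ('r, 'a, 'b) module_scheme \<Rightarrow> 'l \<Rightarrow> 'a \<Rightarrow> 'l \<Rightarrow> 'a"
  where "sum_injection \<Lambda> N l x = (\<lambda>k\<in>\<Lambda>. if k = l then x else \<zero>\<^bsub>N\<^esub>)"

text \<open>
  The homomorphism that a family \<open>h\<^sub>l : P \<rightarrow> N\<close> induces on the direct sum, by its universal property.
  The sum ranges over the support of \<open>f\<close> only, since \<open>\<Lambda>\<close> may be infinite.
\<close>

definition sum_of_maps ::
    "'l set \<Rightarrow> ('r, 'a, 'b) module_scheme \<Rightarrow> ('r, 'c, 'd) module_scheme
      \<Rightarrow> ('l \<Rightarrow> 'a \<Rightarrow> 'c) \<Rightarrow> ('l \<Rightarrow> 'a) \<Rightarrow> 'c"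
  where "sum_of_maps \<Lambda> P N h f = (\<Oplus>\<^bsub>N\<^esub>l\<in>{l \<in> \<Lambda>. f l \<noteq> \<zero>\<^bsub>P\<^esub>}. h l (f l))"

lemma sum_injection_hom:
  assumes "module R N" "l \<in> \<Lambda>"
  shows "sum_injection \<Lambda> N l \<in> module_hom R N (direct_sum_copies \<Lambda> N)"
proof (rule module_homI)
  interpret N: module R N by fact
  show "sum_injection \<Lambda> N l x \<in> carrier (direct_sum_copies \<Lambda> N)" if "x \<in> carrier N" for x
  proof -
    have "finite {k \<in> \<Lambda>. sum_injection \<Lambda> N l x k \<noteq> \<zero>\<^bsub>N\<^esub>}"
      by (rule finite_subset[of _ "{l}"]) (auto simp: sum_injection_def)
    then show ?thesis using that by (auto simp: sum_injection_def)
  qed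
qed (use module.smult_r_null[OF assms(1)] abelian_monoid.l_zero[of N] module.axioms(2)[OF assms(1)] in
    \<open>auto simp: sum_injection_def fun_eq_iff abelian_group_def abelian_monoid.zero_closed\<close>)

lemma direct_sum_induct [consumes 2, case_names zero injection add]:
  assumes "module R N" and f: "f \<in> carrier (direct_sum_copies \<Lambda> N)"
    and zero: "Q \<zero>\<^bsub>direct_sum_copies \<Lambda> N\<^esub>"
    and inj: "\<And>l x. \<lbrakk>l \<in> \<Lambda>; x \<in> carrier N\<rbrakk> \<Longrightarrow> Q (sum_injection \<Lambda> N l x)"
    and add: "\<And>f g. \<lbrakk>f \<in> carrier (direct_sum_copies \<Lambda> N); g \<in> carrier (direct_sum_copies \<Lambda> N); Q f; Q g\<rbrakk>
      \<Longrightarrow> Q (f \<oplus>\<^bsub>direct_sum_copies \<Lambda> N\<^esub> g)"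
  shows "Q f"
proof -
  interpret N: module R N by fact
  let ?S = "direct_sum_copies \<Lambda> N"
  have "Q f" if "finite F" "f \<in> carrier ?S" "{l \<in> \<Lambda>. f l \<noteq> \<zero>\<^bsub>N\<^esub>} \<subseteq> F" "F \<subseteq> \<Lambda>" for F f
    using that
  proof (induction F arbitrary: f)
    case empty
    then have "f = \<zero>\<^bsub>?S\<^esub>" by (auto simp: fun_eq_iff PiE_def extensional_def)
    then show ?case using zero by (simp only:)
  next
    case (insert l F)
    let ?g = "\<lambda>k\<in>\<Lambda>. if k = l then \<zero>\<^bsub>N\<^esub> else f k"
    have fE: "f \<in> \<Lambda> \<rightarrow>\<^sub>E carrier N" and l: "l \<in> \<Lambda>" using insert.prems by auto
    have "{k \<in> \<Lambda>. ?g k \<noteq> \<zero>\<^bsub>N\<^esub>} \<subseteq> F" using insert.prems by auto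
    moreover from this have "?g \<in> carrier ?S"
      using fE finite_subset[OF _ insert.hyps(1)] by (auto simp: PiE_iff)
    ultimately have g: "?g \<in> carrier ?S" "Q ?g" using insert.IH insert.prems by auto
    have i: "sum_injection \<Lambda> N l (f l) \<in> carrier ?S" "Q (sum_injection \<Lambda> N l (f l))"
      using module_hom_closed[OF sum_injection_hom[OF assms(1) l]] inj[OF l] fE l by blast+
    have "f = sum_injection \<Lambda> N l (f l) \<oplus>\<^bsub>?S\<^esub> ?g"
      by (rule extensionalityI[of _ \<Lambda>]) (use fE in \<open>auto simp: sum_injection_def PiE_iff\<close>)
    then show ?case using add[OF i(1) g(1) i(2) g(2)] by simp
  qed
  from this[of "{l \<in> \<Lambda>. f l \<noteq> \<zero>\<^bsub>N\<^esub>}" f] f show ?thesis by simp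
qed

lemma direct_sum_hom_eqI:
  assumes "module R P" "module R N"
    and g: "g \<in> module_hom R (direct_sum_copies \<Lambda> P) N"
    and h: "h \<in> module_hom R (direct_sum_copies \<Lambda> P) N"
    and "\<And>l x. \<lbrakk>l \<in> \<Lambda>; x \<in> carrier P\<rbrakk> \<Longrightarrow> g (sum_injection \<Lambda> P l x) = h (sum_injection \<Lambda> P l x)"
    and "f \<in> carrier (direct_sum_copies \<Lambda> P)"
  shows "g f = h f"
  using assms(1,6)
proof (induction rule: direct_sum_induct)
  case zero
  note S = module_direct_sum_copies[OF assms(1)]
  show ?case using module_hom_zero[OF S assms(2) g] module_hom_zero[OF S assms(2) h] by (simp only:)
next
  case (injection l x)
  then show ?case by (rule assms(5))
next
  case (add f f')
  then show ?case using module_hom_add[OF g add(1,2)] module_hom_add[OF h add(1,2)]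
    by (simp only: add(3,4))
qed

lemma
  assumes "module R P" "module R N" and h: "\<And>l. l \<in> \<Lambda> \<Longrightarrow> h l \<in> module_hom R P N"
  shows sum_of_maps_hom: "sum_of_maps \<Lambda> P N h \<in> module_hom R (direct_sum_copies \<Lambda> P) N"
    and sum_of_maps_injection:
      "\<lbrakk>l \<in> \<Lambda>; x \<in> carrier P\<rbrakk> \<Longrightarrow> sum_of_maps \<Lambda> P N h (sum_injection \<Lambda> P l x) = h l x"
proof -
  interpret P: module R P by fact
  interpret N: module R N by fact
  let ?S = "direct_sum_copies \<Lambda> P"
  interpret S: module R ?S by (rule module_direct_sum_copies[OF assms(1)])
  have hz: "h l \<zero>\<^bsub>P\<^esub> = \<zero>\<^bsub>N\<^esub>" if "l \<in> \<Lambda>" for l by (rule module_hom_zero[OF assms(1,2) h[OF that]])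
  have fc: "f l \<in> carrier P" if "f \<in> carrier ?S" "l \<in> \<Lambda>" for f l using that by auto
  have hc: "h l x \<in> carrier N" if "l \<in> \<Lambda>" "x \<in> carrier P" for l x
    using module_hom_closed[OF h] that by blast
  have large: "sum_of_maps \<Lambda> P N h f = (\<Oplus>\<^bsub>N\<^esub>l\<in>F. h l (f l))"
    if "f \<in> carrier ?S" "finite F" "{l \<in> \<Lambda>. f l \<noteq> \<zero>\<^bsub>P\<^esub>} \<subseteq> F" "F \<subseteq> \<Lambda>" for f F
    unfolding sum_of_maps_def
    by (rule N.M.add.finprod_mono_neutral_cong_left)
      (use that fc[OF that(1)] in \<open>auto simp: hz hc subset_iff\<close>)
  show "sum_of_maps \<Lambda> P N h \<in> module_hom R ?S N"
  proof (rule module_homI)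
    fix f assume f: "f \<in> carrier ?S"
    let ?F = "{l \<in> \<Lambda>. f l \<noteq> \<zero>\<^bsub>P\<^esub>}"
    show "sum_of_maps \<Lambda> P N h f \<in> carrier N"
      unfolding sum_of_maps_def by (rule N.M.finsum_closed) (use fc[OF f] hc in auto)
    show "sum_of_maps \<Lambda> P N h (r \<odot>\<^bsub>?S\<^esub> f) = r \<odot>\<^bsub>N\<^esub> sum_of_maps \<Lambda> P N h f" if r: "r \<in> carrier R" for r
    proof -
      have "sum_of_maps \<Lambda> P N h (r \<odot>\<^bsub>?S\<^esub> f) = (\<Oplus>\<^bsub>N\<^esub>l\<in>?F. h l ((r \<odot>\<^bsub>?S\<^esub> f) l))"
        by (rule large[OF S.smult_closed[OF r f]]) (use f r in auto)
      also have "\<dots> = (\<Oplus>\<^bsub>N\<^esub>l\<in>?F. r \<odot>\<^bsub>N\<^esub> h l (f l))"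
        by (rule N.M.add.finprod_cong') (use r fc[OF f] hc module_hom_smult[OF h] in auto)
      also have "\<dots> = r \<odot>\<^bsub>N\<^esub> (\<Oplus>\<^bsub>N\<^esub>l\<in>?F. h l (f l))"
        by (rule N.finsum_smult_ldistr[symmetric]) (use f r fc[OF f] hc in auto)
      finally show ?thesis by (simp add: sum_of_maps_def)
    qed
    fix g assume g: "g \<in> carrier ?S"
    let ?G = "?F \<union> {l \<in> \<Lambda>. g l \<noteq> \<zero>\<^bsub>P\<^esub>}"
    have "sum_of_maps \<Lambda> P N h (f \<oplus>\<^bsub>?S\<^esub> g) = (\<Oplus>\<^bsub>N\<^esub>l\<in>?G. h l ((f \<oplus>\<^bsub>?S\<^esub> g) l))"
      by (rule large[OF S.M.a_closed[OF f g]]) (use f g in auto)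
    also have "\<dots> = (\<Oplus>\<^bsub>N\<^esub>l\<in>?G. h l (f l) \<oplus>\<^bsub>N\<^esub> h l (g l))"
      by (rule N.M.add.finprod_cong') (use fc[OF f] fc[OF g] hc module_hom_add[OF h] in auto)
    also have "\<dots> = (\<Oplus>\<^bsub>N\<^esub>l\<in>?G. h l (f l)) \<oplus>\<^bsub>N\<^esub> (\<Oplus>\<^bsub>N\<^esub>l\<in>?G. h l (g l))"
      by (rule N.M.finsum_addf) (use fc[OF f] fc[OF g] hc in auto)
    also have "\<dots> = sum_of_maps \<Lambda> P N h f \<oplus>\<^bsub>N\<^esub> sum_of_maps \<Lambda> P N h g"
      using large[OF f, of ?G] large[OF g, of ?G] f g by auto
    finally show "sum_of_maps \<Lambda> P N h (f \<oplus>\<^bsub>?S\<^esub> g)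
      = sum_of_maps \<Lambda> P N h f \<oplus>\<^bsub>N\<^esub> sum_of_maps \<Lambda> P N h g" .
  qed
  show "sum_of_maps \<Lambda> P N h (sum_injection \<Lambda> P l x) = h l x" if l: "l \<in> \<Lambda>" and x: "x \<in> carrier P"
  proof -
    have "sum_of_maps \<Lambda> P N h (sum_injection \<Lambda> P l x) = (\<Oplus>\<^bsub>N\<^esub>k\<in>{l}. h k (sum_injection \<Lambda> P l x k))"
      by (rule large[OF module_hom_closed[OF sum_injection_hom[OF assms(1) l] x]])
        (use l in \<open>auto simp: sum_injection_def\<close>)
    then show ?thesis using l x hc by (simp add: sum_injection_def)
  qed
qed

section \<open>Generation and cogeneration by homomorphisms\<close>

lemma cogenerated_via_imp_separated:
  assumes "module R M" "module R P" "cogenerated_via R P M \<Lambda>" "x \<in> carrier M" "x \<noteq> \<zero>\<^bsub>M\<^esub>"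
  shows "\<exists>\<phi>\<in>module_hom R M P. \<phi> x \<noteq> \<zero>\<^bsub>P\<^esub>"
proof -
  interpret M: module R M by fact
  interpret D: module R "direct_power \<Lambda> P" by (rule module_direct_power[OF assms(2)])
  obtain F where F: "F \<in> module_hom R M (direct_power \<Lambda> P)" "inj_on F (carrier M)"
    using assms(3) by (auto simp: cogenerated_via_def module_mono_def)
  have "F x \<noteq> \<zero>\<^bsub>direct_power \<Lambda> P\<^esub>"
    using module_hom_zero[OF M.module_axioms D.module_axioms F(1)] inj_onD[OF F(2)] assms(4,5)
    by (metis M.M.zero_closed)
  moreover have "F x \<in> \<Lambda> \<rightarrow>\<^sub>E carrier P" using module_hom_closed[OF F(1) assms(4)] by simp
  ultimately obtain l where l: "l \<in> \<Lambda>" "F x l \<noteq> \<zero>\<^bsub>P\<^esub>"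
    by (auto simp: fun_eq_iff PiE_def extensional_def split: if_splits)
  then show ?thesis
    by (intro bexI[of _ "\<lambda>x. F x l"] module_hom_comp[OF F(1) direct_power_component])
qed

lemma separated_imp_cogenerated_via:
  assumes "module R M" "module R P"
    and sep: "\<And>x. \<lbrakk>x \<in> carrier M; x \<noteq> \<zero>\<^bsub>M\<^esub>\<rbrakk> \<Longrightarrow> \<exists>\<phi>\<in>module_hom R M P. \<phi> x \<noteq> \<zero>\<^bsub>P\<^esub>"
  shows "cogenerated_via R P M (module_hom R M P)"
proof -
  let ?\<Lambda> = "module_hom R M P"
  let ?F = "\<lambda>x. \<lambda>\<phi>\<in>?\<Lambda>. \<phi> x"
  have F: "?F \<in> module_hom R M (direct_power ?\<Lambda> P)"
    by (rule module_hom_into_direct_power)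
  moreover have "inj_on ?F (carrier M)"
  proof (rule module_hom_injI[OF assms(1) module_direct_power[OF assms(2)] F])
    fix x assume x: "x \<in> carrier M" "?F x = \<zero>\<^bsub>direct_power ?\<Lambda> P\<^esub>"
    have "\<phi> x = \<zero>\<^bsub>P\<^esub>" if "\<phi> \<in> ?\<Lambda>" for \<phi>
      using fun_cong[OF x(2), of \<phi>] that by simp
    then show "x = \<zero>\<^bsub>M\<^esub>" using sep[OF x(1)] by blast
  qed
  ultimately show ?thesis by (auto simp: cogenerated_via_def module_mono_def)
qed

text \<open>
  An embedding into a power of \<open>P\<close> separates each nonzero element from zero by one of its
  components; conversely, if homomorphisms separate, then all of them together embed \<open>M\<close> into the power
  indexed by \<open>Hom(M, P)\<close>. So the type of the index set does not matter.
\<close>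

lemma cogenerated_by_iff_separated:
  assumes "module R M" "module R P"
  shows "cogenerated_by R P M \<longleftrightarrow>
    (\<forall>x\<in>carrier M. x \<noteq> \<zero>\<^bsub>M\<^esub> \<longrightarrow> (\<exists>\<phi>\<in>module_hom R M P. \<phi> x \<noteq> \<zero>\<^bsub>P\<^esub>))"
  using cogenerated_via_imp_separated[OF assms] separated_imp_cogenerated_via[OF assms]
  unfolding cogenerated_by_def by blast

text \<open>
  The trace of \<open>P\<close> in \<open>N\<close>, that is, the sum of the images of all homomorphisms \<open>P \<rightarrow> N\<close>. Closure
  under sums suffices, as each single image is already a submodule.
\<close>

inductive_set hom_trace ::
    "('r, 'k) ring_scheme \<Rightarrow> ('r, 'p, 'b) module_scheme \<Rightarrow> ('r, 'n, 'd) module_scheme \<Rightarrow> 'n set"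
  for R and P and N where
    image: "\<lbrakk>h \<in> module_hom R P N; p \<in> carrier P\<rbrakk> \<Longrightarrow> h p \<in> hom_trace R P N"
  | add: "\<lbrakk>x \<in> hom_trace R P N; y \<in> hom_trace R P N\<rbrakk> \<Longrightarrow> x \<oplus>\<^bsub>N\<^esub> y \<in> hom_trace R P N"

lemma hom_trace_zero:
  assumes "module R P" "module R N"
  shows "\<zero>\<^bsub>N\<^esub> \<in> hom_trace R P N"
proof -
  interpret P: module R P by fact
  show ?thesis
    using hom_trace.image[OF module_hom_const_zero[OF assms] P.M.zero_closed] by simp
qed

lemma generated_via_imp_hom_trace:
  assumes "module R P" "module R N" "generated_via R P N \<Lambda>"
  shows "carrier N \<subseteq> hom_trace R P N"
proof
  fix y assume "y \<in> carrier N"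
  let ?S = "direct_sum_copies \<Lambda> P"
  obtain F where F: "F \<in> module_hom R ?S N" and "F ` carrier ?S = carrier N"
    using assms(3) by (auto simp: generated_via_def module_epi_def)
  with \<open>y \<in> carrier N\<close> obtain f where f: "f \<in> carrier ?S" "y = F f" by blast
  have "F f \<in> hom_trace R P N"
    using assms(1) f(1)
  proof (induction rule: direct_sum_induct)
    case zero
    show ?case
      using module_hom_zero[OF module_direct_sum_copies[OF assms(1)] assms(2) F]
        hom_trace_zero[OF assms(1,2)] by (simp only:)
  next
    case (injection l x)
    then show ?case
      using hom_trace.image[OF module_hom_comp[OF sum_injection_hom[OF assms(1)] F]] by blast
  next
    case (add f g)
    then show ?case using module_hom_add[OF F add(1,2)] by (simp only: hom_trace.add)
  qed
  then show "y \<in> hom_trace R P N" using f by simp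
qed

lemma hom_trace_imp_generated_via:
  assumes "module R P" "module R N" "carrier N \<subseteq> hom_trace R P N"
  shows "generated_via R P N (module_hom R P N)"
proof -
  interpret P: module R P by fact
  let ?\<Lambda> = "module_hom R P N"
  let ?S = "direct_sum_copies ?\<Lambda> P"
  interpret S: module R ?S by (rule module_direct_sum_copies[OF assms(1)])
  let ?F = "sum_of_maps ?\<Lambda> P N (\<lambda>h. h)"
  have F: "?F \<in> module_hom R ?S N" by (rule sum_of_maps_hom[OF assms(1,2)])
  have "y \<in> ?F ` carrier ?S" if "y \<in> hom_trace R P N" for y
    using that
  proof induction
    case (image h p)
    have "?F (sum_injection ?\<Lambda> P h p) = h p"
      by (rule sum_of_maps_injection[OF assms(1,2)]) (use image in auto)
    moreover have "sum_injection ?\<Lambda> P h p \<in> carrier ?S"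
      by (rule module_hom_closed[OF sum_injection_hom[OF assms(1) image(1)] image(2)])
    ultimately show ?case by (metis imageI)
  next
    case (add x y)
    then obtain f g where "f \<in> carrier ?S" "g \<in> carrier ?S" "x = ?F f" "y = ?F g" by blast
    then show ?case using module_hom_add[OF F, of f g] S.M.a_closed[of f g] by (metis imageI)
  qed
  then have "?F ` carrier ?S = carrier N"
    using assms(3) module_hom_closed[OF F] by blast
  then have "?F \<in> module_epi R ?S N" using F unfolding module_epi_def by blast
  then show ?thesis unfolding generated_via_def by blast
qed

text \<open>
  An epimorphism from a direct sum writes each element of \<open>N\<close> as a finite sum of images of elements
  of \<open>P\<close>; conversely, if such sums exhaust \<open>N\<close>, then the homomorphisms \<open>P \<rightarrow> N\<close>, each used as its
  own index, induce an epimorphism.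
\<close>

lemma generated_by_iff_hom_trace:
  assumes "module R P" "module R N"
  shows "generated_by R P N \<longleftrightarrow> carrier N \<subseteq> hom_trace R P N"
  using generated_via_imp_hom_trace[OF assms] hom_trace_imp_generated_via[OF assms]
  unfolding generated_by_def by blast

section \<open>Generation of the dual\<close>

text \<open>
  By exchanging arguments, a homomorphism \<open>h : P \<rightarrow> Hom(M, E)\<close> becomes one from \<open>M\<close> to \<open>Hom(P, E)\<close>. If
  all of the latter vanish at \<open>x\<close>, then so does each \<open>h(p)\<close>, and with them every sum of such maps; but by
  assumption \<open>f\<close> is such a sum.
\<close>

lemma dual_generated_imp_separated:
  assumes "module R M" "module R P" "module R E"
    and gen: "carrier (Hom_module R M E) \<subseteq> hom_trace R P (Hom_module R M E)"
    and x: "x \<in> carrier M" and f: "f \<in> module_hom R M E" "f x \<noteq> \<zero>\<^bsub>E\<^esub>"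
  shows "\<exists>\<phi>\<in>module_hom R M (Hom_module R P E). \<phi> x \<noteq> \<zero>\<^bsub>Hom_module R P E\<^esub>"
proof (rule ccontr)
  interpret E: module R E by fact
  assume "\<not> ?thesis"
  then have no: "\<phi> x = \<zero>\<^bsub>Hom_module R P E\<^esub>" if "\<phi> \<in> module_hom R M (Hom_module R P E)" for \<phi>
    using that by blast
  have "g x = \<zero>\<^bsub>E\<^esub>" if "g \<in> hom_trace R P (Hom_module R M E)" for g
    using that
  proof induction
    case (image h p)
    show ?case
      using fun_cong[OF no[OF Hom_swap[OF assms(2,1,3) image(1)]], of p] x image(2) by simp
  next
    case (add g g')
    then show ?case using x by simp
  qed
  moreover have "(\<lambda>y\<in>carrier M. f y) \<in> hom_trace R P (Hom_module R M E)"
    using gen restrict_module_hom[OF assms(1,3) f(1)] by blast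
  ultimately show False using f(2) x by force
qed

text \<open>
  The set \<open>K\<close> is a finite set of generators of \<open>P\<close>, expressed by its effect on homomorphisms to \<open>E\<close>. With
  \<open>\<Lambda> = Hom(M, Hom(P, E))\<close>, the map \<open>\<Phi>(m) = (\<phi>(m)(k))\<close>, indexed by \<open>(\<phi>, k) \<in> \<Lambda> \<times> K\<close>, is injective, and \<open>f\<close>
  extends along it to some \<open>g\<close>. Cutting \<open>\<Phi>(m)\<close> into its pieces with fixed \<open>k\<close> writes \<open>f\<close> as a sum of
  maps \<open>h\<^sub>k(k)\<close>, where \<open>h\<^sub>k(p)(m)\<close> is the value of \<open>g\<close> at the family with entry \<open>\<phi>(m)(p)\<close> in each place
  \<open>(\<phi>, k)\<close> and zero in all others. This sum is finite because \<open>K\<close> is; \<open>\<Lambda>\<close> may be infinite.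
\<close>

lemma separated_imp_dual_generated:
  assumes inj: "injective_module R E" and "module R M" "module R P"
    and K: "finite K" "K \<subseteq> carrier P"
    and det: "\<And>g p. \<lbrakk>g \<in> module_hom R P E; \<And>k. k \<in> K \<Longrightarrow> g k = \<zero>\<^bsub>E\<^esub>; p \<in> carrier P\<rbrakk> \<Longrightarrow> g p = \<zero>\<^bsub>E\<^esub>"
    and sep: "\<And>x. \<lbrakk>x \<in> carrier M; x \<noteq> \<zero>\<^bsub>M\<^esub>\<rbrakk>
      \<Longrightarrow> \<exists>\<phi>\<in>module_hom R M (Hom_module R P E). \<phi> x \<noteq> \<zero>\<^bsub>Hom_module R P E\<^esub>"
  shows "carrier (Hom_module R M E) \<subseteq> hom_trace R P (Hom_module R M E)"
proof
  fix f assume f: "f \<in> carrier (Hom_module R M E)"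
  have E: "module R E" using inj by (simp add: injective_module_def)
  interpret E: module R E by (rule E)
  interpret P: module R P by fact
  interpret M: module R M by fact
  let ?\<Lambda> = "module_hom R M (Hom_module R P E)"
  let ?Y = "direct_power (?\<Lambda> \<times> K) E"
  interpret Y: module R ?Y by (rule module_direct_power[OF E])
  define \<Phi> where "\<Phi> = (\<lambda>m. \<lambda>l\<in>?\<Lambda> \<times> K. fst l m (snd l))"
  have \<Phi>: "\<Phi> \<in> module_hom R M ?Y"
    unfolding \<Phi>_def
  proof (rule module_hom_into_direct_power)
    fix l assume "l \<in> ?\<Lambda> \<times> K"
    then have "fst l \<in> ?\<Lambda>" "snd l \<in> carrier P" using K(2) by auto
    then show "(\<lambda>m. fst l m (snd l)) \<in> module_hom R M E" by (rule Hom_valued_eval)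
  qed
  have "inj_on \<Phi> (carrier M)"
  proof (rule module_hom_injI[OF \<open>module R M\<close> Y.module_axioms \<Phi>], rule ccontr)
    fix x assume x: "x \<in> carrier M" "\<Phi> x = \<zero>\<^bsub>?Y\<^esub>" "x \<noteq> \<zero>\<^bsub>M\<^esub>"
    obtain \<phi> where \<phi>: "\<phi> \<in> ?\<Lambda>" "\<phi> x \<noteq> \<zero>\<^bsub>Hom_module R P E\<^esub>" using sep[OF x(1,3)] by blast
    have "\<phi> x k = \<zero>\<^bsub>E\<^esub>" if "k \<in> K" for k
      using fun_cong[OF x(2), of "(\<phi>, k)"] that \<phi>(1) by (simp add: \<Phi>_def)
    then have "\<phi> x p = \<zero>\<^bsub>E\<^esub>" if "p \<in> carrier P" for p
      using det[OF Hom_valued_apply[OF \<phi>(1) x(1)]] that by blast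
    then have "\<phi> x = \<zero>\<^bsub>Hom_module R P E\<^esub>"
      by (intro extensionalityI[OF Hom_valued_extensional[OF \<phi>(1) x(1)]]) simp_all
    then show False using \<phi>(2) by simp
  qed
  then have "\<Phi> \<in> module_mono R M ?Y" using \<Phi> by (simp add: module_mono_def)
  moreover have "f \<in> module_hom R M E" using f by simp
  ultimately obtain g where g: "g \<in> module_hom R ?Y E" "\<And>m. m \<in> carrier M \<Longrightarrow> g (\<Phi> m) = f m"
    using injective_extension[OF inj \<open>module R M\<close> Y.module_axioms] by blast
  \<comment> \<open>\<open>part L m\<close> is \<open>\<Phi> m\<close> with the entries outside \<open>L\<close> replaced by zero; \<open>slot k p m\<close> agrees with
    \<open>part {k} m\<close> except that \<open>\<phi> m\<close> is evaluated at \<open>p\<close>. So \<open>slot\<close> is linear in \<open>p\<close> and in \<open>m\<close>, and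
    \<open>p = k\<close> gives back the piece of \<open>\<Phi> m\<close> at \<open>k\<close>.\<close>
  define part where "part L m = (\<lambda>l\<in>?\<Lambda> \<times> K. if snd l \<in> L then fst l m (snd l) else \<zero>\<^bsub>E\<^esub>)" for L m
  define slot where "slot k p m = (\<lambda>l\<in>?\<Lambda> \<times> K. if snd l = k then fst l m p else \<zero>\<^bsub>E\<^esub>)" for k p m
  have val: "\<phi> m p \<in> carrier E" if "\<phi> \<in> ?\<Lambda>" "m \<in> carrier M" "p \<in> carrier P" for \<phi> m p
    by (rule module_hom_closed[OF Hom_valued_apply[OF that(1,2)] that(3)])
  have part_closed: "part L m \<in> carrier ?Y" if "m \<in> carrier M" for L m
    using val[OF _ that] K(2) by (auto simp: part_def)
  have slot_closed: "slot k p m \<in> carrier ?Y" if "m \<in> carrier M" "p \<in> carrier P" for k p m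
    using val[OF _ that] by (auto simp: slot_def)
  have slot_hom: "(\<lambda>p. \<lambda>m\<in>carrier M. g (slot k p m)) \<in> module_hom R P (Hom_module R M E)" for k
  proof (rule module_hom_into_Hom[OF \<open>module R P\<close> \<open>module R M\<close> E])
    fix p assume p: "p \<in> carrier P"
    have "slot k p \<in> module_hom R M ?Y"
      unfolding slot_def
    proof (rule module_hom_into_direct_power)
      fix l assume "l \<in> ?\<Lambda> \<times> K"
      then have "fst l \<in> ?\<Lambda>" by auto
      then have "(\<lambda>m. fst l m p) \<in> module_hom R M E" using p by (rule Hom_valued_eval)
      then show "(\<lambda>m. if snd l = k then fst l m p else \<zero>\<^bsub>E\<^esub>) \<in> module_hom R M E"
        using module_hom_const_zero[OF \<open>module R M\<close> E] by (cases "snd l = k") simp_all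
    qed
    then show "(\<lambda>m. g (slot k p m)) \<in> module_hom R M E" by (rule module_hom_comp) (rule g(1))
  next
    fix m assume m: "m \<in> carrier M"
    have "(\<lambda>p. slot k p m) \<in> module_hom R P ?Y"
      unfolding slot_def
    proof (rule module_hom_into_direct_power)
      fix l assume "l \<in> ?\<Lambda> \<times> K"
      then have "fst l \<in> ?\<Lambda>" by auto
      then have "fst l m \<in> module_hom R P E" using m by (rule Hom_valued_apply)
      then show "(\<lambda>p. if snd l = k then fst l m p else \<zero>\<^bsub>E\<^esub>) \<in> module_hom R P E"
        using module_hom_const_zero[OF \<open>module R P\<close> E] by (cases "snd l = k") simp_all
    qed
    then show "(\<lambda>p. g (slot k p m)) \<in> module_hom R P E" by (rule module_hom_comp) (rule g(1))
  qed
  have "(\<lambda>m\<in>carrier M. g (part L m)) \<in> hom_trace R P (Hom_module R M E)" if "L \<subseteq> K" for L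
    using finite_subset[OF that K(1)] that
  proof (induction L)
    case empty
    have "part {} m = \<zero>\<^bsub>?Y\<^esub>" for m by (auto simp: part_def)
    then have "(\<lambda>m\<in>carrier M. g (part {} m)) = \<zero>\<^bsub>Hom_module R M E\<^esub>"
      using module_hom_zero[OF Y.module_axioms E g(1)] by (simp only: Hom_module_simps)
    then show ?case
      using hom_trace_zero[OF \<open>module R P\<close> module_Hom_module[OF \<open>module R M\<close> E]] by (simp only:)
  next
    case (insert k L)
    have k: "k \<in> carrier P" using insert.prems K(2) by blast
    have "g (part (insert k L) m) = g (slot k k m) \<oplus>\<^bsub>E\<^esub> g (part L m)" if m: "m \<in> carrier M" for m
    proof -
      have "part (insert k L) m = slot k k m \<oplus>\<^bsub>?Y\<^esub> part L m"
        using insert.hyps insert.prems val[OF _ m] K(2)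
        by (auto simp: part_def slot_def fun_eq_iff subset_iff)
      then show ?thesis using module_hom_add[OF g(1) slot_closed[OF m k] part_closed[OF m]] by (simp only:)
    qed
    then have "(\<lambda>m\<in>carrier M. g (part (insert k L) m)) =
        (\<lambda>m\<in>carrier M. g (slot k k m)) \<oplus>\<^bsub>Hom_module R M E\<^esub> (\<lambda>m\<in>carrier M. g (part L m))"
      by (auto simp: fun_eq_iff)
    moreover have "(\<lambda>m\<in>carrier M. g (slot k k m)) \<in> hom_trace R P (Hom_module R M E)"
      using hom_trace.image[OF slot_hom k] .
    ultimately show ?case using insert.IH insert.prems by (simp only: hom_trace.add insert_subset)
  qed
  from this[OF order_refl] have "(\<lambda>m\<in>carrier M. g (part K m)) \<in> hom_trace R P (Hom_module R M E)" .
  moreover have "part K = \<Phi>" by (auto simp: part_def \<Phi>_def fun_eq_iff)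
  then have "(\<lambda>m\<in>carrier M. g (part K m)) = f"
    using g(2) f by (intro extensionalityI[of _ "carrier M"]) auto
  ultimately show "f \<in> hom_trace R P (Hom_module R M E)" by simp
qed

section \<open>Quotients by annihilated parts\<close>

lemma module_isomorphic_sym:
  assumes "module R M" "module R N" "module_isomorphic R M N"
  shows "module_isomorphic R N M"
proof -
  obtain f where f: "f \<in> module_hom R M N" "bij_betw f (carrier M) (carrier N)"
    using assms(3) by (auto simp: module_isomorphic_def)
  then show ?thesis
    unfolding module_isomorphic_def
    by (intro bexI[OF _ module_hom_inverse[OF assms(1,2) f]] bij_betw_inv_into)
qed

text \<open>
  The first isomorphism theorem, in both directions. It replaces computations with cosets by an
  epimorphism \<open>p\<close> with kernel \<open>D\<close>.
\<close>

lemma isomorphic_quotient_iff_epi: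
  assumes "module R A" "module R M" "submodule D R A"
  shows "module_isomorphic R (quotient_module A D) M \<longleftrightarrow>
    (\<exists>p\<in>module_epi R A M. \<forall>a\<in>carrier A. p a = \<zero>\<^bsub>M\<^esub> \<longleftrightarrow> a \<in> D)"
proof -
  let ?Q = "quotient_module A D"
  let ?q = "\<lambda>a. D +>\<^bsub>A\<^esub> a"
  interpret Q: module R ?Q by (rule module_quotient_module[OF assms(1,3)])
  have q: "?q \<in> module_hom R A ?Q" and q_onto: "?q ` carrier A = carrier ?Q"
    using quotient_proj_epi[OF assms(1,3)] by (simp_all add: module_epi_def)
  note q_zero = quotient_proj_eq_zero_iff[OF assms(1,3)]
  show ?thesis
  proof
    assume "module_isomorphic R ?Q M"
    then obtain f where f: "f \<in> module_hom R ?Q M" "inj_on f (carrier ?Q)" "f ` carrier ?Q = carrier M"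
      by (auto simp: module_isomorphic_def bij_betw_def)
    have "(\<lambda>a. f (?q a)) ` carrier A = carrier M"
      using q_onto f(3) by (metis image_image)
    then have "(\<lambda>a. f (?q a)) \<in> module_epi R A M"
      using module_hom_comp[OF q f(1)] by (simp add: module_epi_def)
    moreover have "f (?q a) = \<zero>\<^bsub>M\<^esub> \<longleftrightarrow> a \<in> D" if a: "a \<in> carrier A" for a
    proof -
      have "f (?q a) = \<zero>\<^bsub>M\<^esub> \<longleftrightarrow> f (?q a) = f \<zero>\<^bsub>?Q\<^esub>"
        using module_hom_zero[OF Q.module_axioms assms(2) f(1)] by simp
      also have "\<dots> \<longleftrightarrow> ?q a = \<zero>\<^bsub>?Q\<^esub>"
        by (rule inj_on_eq_iff[OF f(2) module_hom_closed[OF q a] Q.M.zero_closed])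
      finally show ?thesis using q_zero[OF a] by simp
    qed
    ultimately show "\<exists>p\<in>module_epi R A M. \<forall>a\<in>carrier A. p a = \<zero>\<^bsub>M\<^esub> \<longleftrightarrow> a \<in> D"
      by (intro bexI[of _ "\<lambda>a. f (?q a)"]) simp_all
  next
    assume "\<exists>p\<in>module_epi R A M. \<forall>a\<in>carrier A. p a = \<zero>\<^bsub>M\<^esub> \<longleftrightarrow> a \<in> D"
    then obtain p where p: "p \<in> module_hom R A M" "p ` carrier A = carrier M"
      and p_zero: "\<And>a. a \<in> carrier A \<Longrightarrow> p a = \<zero>\<^bsub>M\<^esub> \<longleftrightarrow> a \<in> D"
      by (auto simp: module_epi_def)
    obtain f where f: "f \<in> module_hom R ?Q M" "\<And>a. a \<in> carrier A \<Longrightarrow> f (?q a) = p a"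
      using factor_through_epi[OF assms(1) Q.module_axioms assms(2) quotient_proj_epi[OF assms(1,3)] p(1)]
        q_zero p_zero by blast
    have "f ` carrier ?Q = carrier M"
      using f(2) q_onto p(2) by (metis (no_types, lifting) image_cong image_image)
    moreover have "inj_on f (carrier ?Q)"
    proof (rule module_hom_injI[OF Q.module_axioms assms(2) f(1)])
      fix x assume "x \<in> carrier ?Q" and fx: "f x = \<zero>\<^bsub>M\<^esub>"
      then have "x \<in> ?q ` carrier A" by (simp only: q_onto)
      then obtain a where a: "a \<in> carrier A" "x = ?q a" by (rule imageE)
      then show "x = \<zero>\<^bsub>?Q\<^esub>" using fx f(2) p_zero q_zero by simp
    qed
    ultimately show "module_isomorphic R ?Q M"
      using f(1) by (auto simp: module_isomorphic_def bij_betw_def)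
  qed
qed

lemma annihilated_part_submodule:
  assumes "module R C" "ideal I R"
  shows "submodule (annihilated_part C I) R C"
proof -
  interpret C: module R C by fact
  interpret I: ideal I R by fact
  show ?thesis
  proof (rule C.submoduleI)
    fix r c assume r: "r \<in> carrier R" and c: "c \<in> annihilated_part C I"
    have "i \<odot>\<^bsub>C\<^esub> (r \<odot>\<^bsub>C\<^esub> c) = \<zero>\<^bsub>C\<^esub>" if i: "i \<in> I" for i
    proof -
      have "c \<in> carrier C" using c by (simp add: annihilated_part_def)
      then have "i \<odot>\<^bsub>C\<^esub> (r \<odot>\<^bsub>C\<^esub> c) = r \<odot>\<^bsub>C\<^esub> (i \<odot>\<^bsub>C\<^esub> c)"
        using r I.Icarr[OF i] C.R.m_comm[of i r] by (simp flip: C.smult_assoc1)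
      then show ?thesis using r c i by (simp add: annihilated_part_def)
    qed
    then show "r \<odot>\<^bsub>C\<^esub> c \<in> annihilated_part C I" using r c by (simp add: annihilated_part_def)
  qed (auto simp: annihilated_part_def I.Icarr C.smult_r_minus C.smult_r_distr)
qed

text \<open>
  If \<open>c \<in> C\<close> represents \<open>x\<close>, then \<open>c\<close> is not in \<open>C[I]\<close>, so \<open>i c \<noteq> 0\<close> for some \<open>i \<in> I\<close> and
  \<open>f(i c) \<noteq> 0\<close> for some \<open>f : C \<rightarrow> E\<close>. The homomorphism \<open>d \<mapsto> (j \<mapsto> f(j d))\<close> from \<open>C\<close> to \<open>I\<^sup>o\<close> kills
  \<open>C[I]\<close>, hence descends to \<open>M\<close>, where it is nonzero at \<open>x\<close>.
\<close>

lemma quotient_by_annihilated_part_separated: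
  assumes "module R C" "module R M" "module R E" "ideal I R"
    and p: "p \<in> module_epi R C M" "\<And>c. c \<in> carrier C \<Longrightarrow> p c = \<zero>\<^bsub>M\<^esub> \<longleftrightarrow> c \<in> annihilated_part C I"
    and cogen: "\<And>c. \<lbrakk>c \<in> carrier C; c \<noteq> \<zero>\<^bsub>C\<^esub>\<rbrakk> \<Longrightarrow> \<exists>f\<in>module_hom R C E. f c \<noteq> \<zero>\<^bsub>E\<^esub>"
    and x: "x \<in> carrier M" "x \<noteq> \<zero>\<^bsub>M\<^esub>"
  shows "\<exists>\<phi>\<in>module_hom R M (Hom_module R (ideal_module R I) E).
    \<phi> x \<noteq> \<zero>\<^bsub>Hom_module R (ideal_module R I) E\<^esub>"
proof -
  interpret C: module R C by fact
  interpret E: module R E by fact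
  interpret I: ideal I R by fact
  let ?I = "ideal_module R I"
  have I: "module R ?I" by (rule module_ideal_module[OF C.R.is_cring assms(4)])
  obtain c where c: "c \<in> carrier C" "x = p c" using p(1) x(1) by (auto simp: module_epi_def)
  then obtain i where i: "i \<in> I" "i \<odot>\<^bsub>C\<^esub> c \<noteq> \<zero>\<^bsub>C\<^esub>"
    using p(2) x(2) by (auto simp: annihilated_part_def)
  obtain f where f: "f \<in> module_hom R C E" "f (i \<odot>\<^bsub>C\<^esub> c) \<noteq> \<zero>\<^bsub>E\<^esub>"
    using cogen[OF _ i(2)] c(1) i(1) I.Icarr by blast
  let ?\<phi> = "\<lambda>c. \<lambda>j\<in>carrier ?I. f (j \<odot>\<^bsub>C\<^esub> c)"
  have \<phi>: "?\<phi> \<in> module_hom R C (Hom_module R ?I E)"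
  proof (rule module_hom_into_Hom[OF assms(1) I assms(3)])
    show "(\<lambda>j. f (j \<odot>\<^bsub>C\<^esub> d)) \<in> module_hom R ?I E" if "d \<in> carrier C" for d
      by (rule module_homI) (use that in \<open>simp_all add: I.Icarr C.smult_l_distr C.smult_assoc1
        module_hom_closed[OF f(1)] module_hom_add[OF f(1)] module_hom_smult[OF f(1)]\<close>)
    show "(\<lambda>d. f (j \<odot>\<^bsub>C\<^esub> d)) \<in> module_hom R C E" if "j \<in> carrier ?I" for j
    proof (rule module_homI)
      fix r d assume r: "r \<in> carrier R" and d: "d \<in> carrier C"
      have j: "j \<in> carrier R" using that I.Icarr by simp
      have "j \<odot>\<^bsub>C\<^esub> (r \<odot>\<^bsub>C\<^esub> d) = r \<odot>\<^bsub>C\<^esub> (j \<odot>\<^bsub>C\<^esub> d)"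
        using r d j by (simp add: C.R.m_comm flip: C.smult_assoc1)
      then show "f (j \<odot>\<^bsub>C\<^esub> (r \<odot>\<^bsub>C\<^esub> d)) = r \<odot>\<^bsub>E\<^esub> f (j \<odot>\<^bsub>C\<^esub> d)"
        using module_hom_smult[OF f(1) r, of "j \<odot>\<^bsub>C\<^esub> d"] j d by simp
    qed (use that in \<open>simp_all add: I.Icarr C.smult_r_distr
        module_hom_closed[OF f(1)] module_hom_add[OF f(1)]\<close>)
  qed
  have "?\<phi> d = \<zero>\<^bsub>Hom_module R ?I E\<^esub>" if "d \<in> carrier C" "p d = \<zero>\<^bsub>M\<^esub>" for d
    using p(2) that module_hom_zero[OF assms(1,3) f(1)]
    by (auto simp: annihilated_part_def fun_eq_iff)
  from factor_through_epi[OF assms(1,2) module_Hom_module[OF I assms(3)] p(1) \<phi> this]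
  obtain \<psi> where \<psi>: "\<psi> \<in> module_hom R M (Hom_module R ?I E)" "\<And>d. d \<in> carrier C \<Longrightarrow> \<psi> (p d) = ?\<phi> d"
    by blast
  have "\<psi> x i \<noteq> \<zero>\<^bsub>E\<^esub>" using \<psi>(2)[OF c(1)] c(2) f(2) i(1) by simp
  then have "\<psi> x \<noteq> \<zero>\<^bsub>Hom_module R ?I E\<^esub>" using i(1) by auto
  then show ?thesis by (rule bexI[OF _ \<psi>(1)])
qed

lemma isomorphic_quotient_by_annihilated_part_separated:
  assumes "noetherian_local_ring R \<mm>" and "injective_hull R (residue_field R \<mm>) E"
    and I: "ideal I R" and M: "module R M" and C: "module R C"
    and iso: "module_isomorphic R (quotient_module C (annihilated_part C I)) M"
    and x: "x \<in> carrier M" "x \<noteq> \<zero>\<^bsub>M\<^esub>"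
  shows "\<exists>\<phi>\<in>module_hom R M (Hom_module R (ideal_module R I) E).
    \<phi> x \<noteq> \<zero>\<^bsub>Hom_module R (ideal_module R I) E\<^esub>"
proof -
  have E: "module R E" using assms(2) by (simp add: injective_hull_def injective_module_def)
  obtain p where p: "p \<in> module_epi R C M"
    "\<And>c. c \<in> carrier C \<Longrightarrow> p c = \<zero>\<^bsub>M\<^esub> \<longleftrightarrow> c \<in> annihilated_part C I"
    using iso isomorphic_quotient_iff_epi[OF C M annihilated_part_submodule[OF C I]] by blast
  have "\<exists>f\<in>module_hom R C E. f c \<noteq> \<zero>\<^bsub>E\<^esub>" if "c \<in> carrier C" "c \<noteq> \<zero>\<^bsub>C\<^esub>" for c
    by (rule residue_field_hull_cogenerates[OF assms(1,2) C that]) blast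
  from quotient_by_annihilated_part_separated[OF C M E I p this x] show ?thesis .
qed

lemma ideal_times_submodule:
  assumes "module R A" "ideal I R" "submodule B R A"
  shows "submodule (ideal_times A I B) R A"
proof -
  interpret A: module R A by fact
  interpret I: ideal I R by fact
  interpret B: submodule B R A by fact
  have closed: "x \<in> carrier A" if "x \<in> ideal_times A I B" for x
    using that by induction (use I.Icarr B.subset in auto)
  have smult: "r \<odot>\<^bsub>A\<^esub> x \<in> ideal_times A I B" if r: "r \<in> carrier R" and "x \<in> ideal_times A I B" for r x
    using that(2)
  proof induction
    case (prod i b)
    have "r \<odot>\<^bsub>A\<^esub> (i \<odot>\<^bsub>A\<^esub> b) = (r \<otimes>\<^bsub>R\<^esub> i) \<odot>\<^bsub>A\<^esub> b"
      using A.smult_assoc1[OF r I.Icarr[OF prod(1)]] B.subset prod(2) by auto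
    then show ?case using ideal_times.prod[OF I.I_l_closed[OF prod(1) r] prod(2), of A] by simp
  next
    case (sum x y)
    then show ?case
      using A.smult_r_distr[OF r closed closed] ideal_times.sum[OF sum(3,4)] by simp
  qed
  have zero: "\<zero>\<^bsub>A\<^esub> \<in> B" using B.one_closed by simp
  show ?thesis
  proof (rule A.submoduleI)
    show "ideal_times A I B \<subseteq> carrier A" using closed by blast
    show "\<zero>\<^bsub>A\<^esub> \<in> ideal_times A I B"
      using ideal_times.prod[OF I.zero_closed zero, of A] by simp
    show "\<ominus>\<^bsub>A\<^esub> x \<in> ideal_times A I B" if "x \<in> ideal_times A I B" for x
      using smult[of "\<ominus>\<^bsub>R\<^esub> \<one>\<^bsub>R\<^esub>" x] closed[OF that] that by (simp add: A.smult_l_minus)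
  qed (auto intro: smult ideal_times.sum)
qed

text \<open>
  The class of \<open>a\<close> in \<open>C = A/IB\<close> is annihilated by \<open>I\<close> if and only if \<open>I a \<subseteq> IB\<close>, that is,
  \<open>a \<in> (IB) : I = B\<close>. So \<open>C[I]\<close> is the kernel of the map \<open>C \<rightarrow> M\<close> induced by \<open>p\<close>.
\<close>

lemma colon_eq_imp_quotient_by_annihilated_part:
  assumes "module R A" "module R M" "ideal I R" "submodule B R A"
    and p: "p \<in> module_epi R A M" "\<And>a. a \<in> carrier A \<Longrightarrow> p a = \<zero>\<^bsub>M\<^esub> \<longleftrightarrow> a \<in> B"
    and colon: "B = colon A (ideal_times A I B) I"
  defines "C \<equiv> quotient_module A (ideal_times A I B)"
  shows "module R C" and "module_isomorphic R (quotient_module C (annihilated_part C I)) M"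
proof -
  interpret A: module R A by fact
  interpret M: module R M by fact
  interpret I: ideal I R by fact
  interpret B: submodule B R A by fact
  let ?D = "ideal_times A I B"
  have D: "submodule ?D R A" by (rule ideal_times_submodule[OF assms(1,3,4)])
  show C: "module R C" unfolding C_def by (rule module_quotient_module[OF assms(1) D])
  have D_le_B: "?D \<subseteq> B"
  proof
    fix x assume "x \<in> ?D"
    then show "x \<in> B"
      by induction (use B.smult_closed B.m_closed I.Icarr in auto)
  qed
  let ?q = "\<lambda>a. ?D +>\<^bsub>A\<^esub> a"
  have q_epi: "?q \<in> module_epi R A C" unfolding C_def by (rule quotient_proj_epi[OF assms(1) D])
  then have q: "?q \<in> module_hom R A C" and q_onto: "?q ` carrier A = carrier C"
    by (simp_all add: module_epi_def)
  have q_zero: "?q a = \<zero>\<^bsub>C\<^esub> \<longleftrightarrow> a \<in> ?D" if "a \<in> carrier A" for a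
    unfolding C_def by (rule quotient_proj_eq_zero_iff[OF assms(1) D that])
  have ph: "p \<in> module_hom R A M" "p ` carrier A = carrier M" using p(1) by (simp_all add: module_epi_def)
  obtain p' where p': "p' \<in> module_hom R C M" "\<And>a. a \<in> carrier A \<Longrightarrow> p' (?q a) = p a"
    using factor_through_epi[OF assms(1) C assms(2) q_epi ph(1)] q_zero p(2) D_le_B
    by (metis subsetD)
  have "p' ` carrier C = carrier M"
    using p'(2) q_onto ph(2) by (metis (no_types, lifting) image_cong image_image)
  then have "p' \<in> module_epi R C M" using p'(1) by (simp add: module_epi_def)
  moreover have "p' c = \<zero>\<^bsub>M\<^esub> \<longleftrightarrow> c \<in> annihilated_part C I" if "c \<in> carrier C" for c
  proof -
    have "c \<in> ?q ` carrier A" using that by (simp only: q_onto)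
    then obtain a where a: "a \<in> carrier A" "c = ?q a" by (rule imageE)
    have "i \<odot>\<^bsub>C\<^esub> c = \<zero>\<^bsub>C\<^esub> \<longleftrightarrow> i \<odot>\<^bsub>A\<^esub> a \<in> ?D" if "i \<in> I" for i
      using module_hom_smult[OF q I.Icarr[OF that] a(1)] q_zero[of "i \<odot>\<^bsub>A\<^esub> a"] I.Icarr[OF that] a
      by simp
    then have "c \<in> annihilated_part C I \<longleftrightarrow> a \<in> colon A ?D I"
      using that a(1) by (simp add: annihilated_part_def colon_def)
    then show ?thesis using p'(2)[OF a(1)] p(2)[OF a(1)] a(2) colon by simp
  qed
  ultimately show "module_isomorphic R (quotient_module C (annihilated_part C I)) M"
    using isomorphic_quotient_iff_epi[OF C assms(2) annihilated_part_submodule[OF C assms(3)]] by blast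
qed

section \<open>Presentations by free modules\<close>

text \<open>
  Every homomorphism from a free module \<open>A\<close> to \<open>I\<^sup>o\<close> comes from one to \<open>E\<close>, by way of the map
  \<open>Hom(A, E) \<rightarrow> Hom(A, I\<^sup>o)\<close> that sends \<open>h\<close> to \<open>a \<mapsto> (i \<mapsto> h(i a))\<close>. On the unit vector at \<open>s\<close> the value of
  \<open>\<phi>\<close> is a homomorphism \<open>I \<rightarrow> E\<close>, hence multiplication by some \<open>e\<^sub>s\<close>, and \<open>h\<close> is the homomorphism that
  takes this unit vector to \<open>e\<^sub>s\<close>.
\<close>

lemma direct_sum_dual_lift:
  assumes inj: "injective_module R E" and I: "ideal I R"
    and \<phi>: "\<phi> \<in> module_hom R (direct_sum_copies S (ideal_module R (carrier R)))
      (Hom_module R (ideal_module R I) E)"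
  obtains h where "h \<in> module_hom R (direct_sum_copies S (ideal_module R (carrier R))) E"
    "\<And>a i. \<lbrakk>a \<in> carrier (direct_sum_copies S (ideal_module R (carrier R))); i \<in> I\<rbrakk>
      \<Longrightarrow> h (i \<odot>\<^bsub>direct_sum_copies S (ideal_module R (carrier R))\<^esub> a) = \<phi> a i"
proof -
  interpret E: module R E using inj by (simp add: injective_module_def)
  interpret I: ideal I R by fact
  let ?F = "ideal_module R (carrier R)"
  let ?I = "ideal_module R I"
  let ?A = "direct_sum_copies S ?F"
  let ?u = "sum_injection S ?F"
  interpret F: module R ?F by (rule module_ideal_module[OF E.R.is_cring E.R.oneideal])
  interpret A: module R ?A by (rule module_direct_sum_copies[OF F.module_axioms])
  have u: "?u s \<in> module_hom R ?F ?A" if "s \<in> S" for s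
    by (rule sum_injection_hom[OF F.module_axioms that])
  have "\<exists>e. e \<in> carrier E \<and> (\<forall>i\<in>I. \<phi> (?u s \<one>\<^bsub>R\<^esub>) i = i \<odot>\<^bsub>E\<^esub> e)" if "s \<in> S" for s
  proof -
    have "?u s \<one>\<^bsub>R\<^esub> \<in> carrier ?A" by (rule module_hom_closed[OF u[OF that]]) simp
    from injective_module_ideal[OF inj I Hom_valued_apply[OF \<phi> this]] show ?thesis
      by (metis (no_types, lifting))
  qed
  then obtain e where e: "\<And>s. s \<in> S \<Longrightarrow> e s \<in> carrier E"
    "\<And>s i. \<lbrakk>s \<in> S; i \<in> I\<rbrakk> \<Longrightarrow> \<phi> (?u s \<one>\<^bsub>R\<^esub>) i = i \<odot>\<^bsub>E\<^esub> e s"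
    by metis
  let ?m = "\<lambda>s r. r \<odot>\<^bsub>E\<^esub> e s"
  let ?h = "sum_of_maps S ?F E ?m"
  have m: "?m s \<in> module_hom R ?F E" if "s \<in> S" for s
    by (rule module_homI) (use e(1)[OF that] in \<open>simp_all add: E.smult_l_distr E.smult_assoc1\<close>)
  have h: "?h \<in> module_hom R ?A E" by (rule sum_of_maps_hom[OF F.module_axioms E.module_axioms m])
  have hu: "?h (?u s r) = r \<odot>\<^bsub>E\<^esub> e s" if "s \<in> S" "r \<in> carrier R" for s r
    by (rule sum_of_maps_injection[OF F.module_axioms E.module_axioms m]) (use that in simp_all)
  show ?thesis
  proof (rule that[OF h])
    fix a i assume a: "a \<in> carrier ?A" and i: "i \<in> I"
    have iR: "i \<in> carrier R" by (rule I.Icarr[OF i])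
    have "i \<odot>\<^bsub>E\<^esub> ?h a = \<phi> a i"
    proof (rule direct_sum_hom_eqI[OF F.module_axioms E.module_axioms _ _ _ a])
      show "(\<lambda>a. i \<odot>\<^bsub>E\<^esub> ?h a) \<in> module_hom R ?A E"
        by (rule module_hom_pointwise_smult[OF A.module_axioms E.module_axioms iR h])
      show "(\<lambda>a. \<phi> a i) \<in> module_hom R ?A E" by (rule Hom_valued_eval[OF \<phi>]) (simp add: i)
      fix s r assume s: "s \<in> S" and "r \<in> carrier ?F"
      then have r: "r \<in> carrier R" by simp
      have one: "?u s \<one>\<^bsub>R\<^esub> \<in> carrier ?A" by (rule module_hom_closed[OF u[OF s]]) simp
      have "?u s r = r \<odot>\<^bsub>?A\<^esub> ?u s \<one>\<^bsub>R\<^esub>"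
        using module_hom_smult[OF u[OF s] r, of "\<one>\<^bsub>R\<^esub>"] r by simp
      then have "\<phi> (?u s r) i = r \<odot>\<^bsub>E\<^esub> \<phi> (?u s \<one>\<^bsub>R\<^esub>) i"
        using module_hom_smult[OF \<phi> r one] i by simp
      also have "\<dots> = i \<odot>\<^bsub>E\<^esub> ?h (?u s r)"
        using e[OF s] i iR r hu[OF s r] by (simp add: E.R.m_comm flip: E.smult_assoc1)
      finally show "i \<odot>\<^bsub>E\<^esub> ?h (?u s r) = \<phi> (?u s r) i" by simp
    qed
    then show "?h (i \<odot>\<^bsub>?A\<^esub> a) = \<phi> a i" using module_hom_smult[OF h iR a] by simp
  qed
qed

text \<open>
  The same lifting property, transported along the coordinate isomorphism of a basis.
\<close>

lemma free_dual_lift: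
  assumes inj: "injective_module R E" and I: "ideal I R" and "free_module R A"
    and \<phi>: "\<phi> \<in> module_hom R A (Hom_module R (ideal_module R I) E)"
  obtains h where "h \<in> module_hom R A E"
    "\<And>a i. \<lbrakk>a \<in> carrier A; i \<in> I\<rbrakk> \<Longrightarrow> h (i \<odot>\<^bsub>A\<^esub> a) = \<phi> a i"
proof -
  interpret A: module R A using assms(3) by (simp add: free_module_def)
  interpret I: ideal I R by fact
  let ?F = "ideal_module R (carrier R)"
  interpret F: module R ?F by (rule module_ideal_module[OF A.R.is_cring A.R.oneideal])
  obtain S where S: "is_basis R A S" using assms(3) by (auto simp: free_module_def)
  let ?A0 = "direct_sum_copies S ?F"
  interpret A0: module R ?A0 by (rule module_direct_sum_copies[OF F.module_axioms])
  define L where "L = sum_of_maps S ?F A (\<lambda>s r. r \<odot>\<^bsub>A\<^esub> s)"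
  have L: "L \<in> module_hom R ?A0 A"
    unfolding L_def
  proof (rule sum_of_maps_hom[OF F.module_axioms A.module_axioms])
    fix s assume "s \<in> S"
    then have "s \<in> carrier A" using S by (auto simp: is_basis_def)
    then show "(\<lambda>r. r \<odot>\<^bsub>A\<^esub> s) \<in> module_hom R ?F A"
      by (intro module_homI) (simp_all add: A.smult_l_distr A.smult_assoc1)
  qed
  have bij: "bij_betw L (carrier ?A0) (carrier A)"
    using S by (simp add: is_basis_def L_def sum_of_maps_def[abs_def])
  let ?L' = "inv_into (carrier ?A0) L"
  have L': "?L' \<in> module_hom R A ?A0"
    by (rule module_hom_inverse[OF A0.module_axioms A.module_axioms L bij])
  obtain h0 where h0: "h0 \<in> module_hom R ?A0 E"
    "\<And>a i. \<lbrakk>a \<in> carrier ?A0; i \<in> I\<rbrakk> \<Longrightarrow> h0 (i \<odot>\<^bsub>?A0\<^esub> a) = \<phi> (L a) i"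
    using direct_sum_dual_lift[OF inj I module_hom_comp[OF L \<phi>]] by blast
  show ?thesis
  proof (rule that[OF module_hom_comp[OF L' h0(1)]])
    fix a i assume a: "a \<in> carrier A" and i: "i \<in> I"
    have "L (?L' a) = a" using bij a by (simp add: bij_betw_inv_into_right)
    then show "h0 (?L' (i \<odot>\<^bsub>A\<^esub> a)) = \<phi> a i"
      using module_hom_smult[OF L' I.Icarr[OF i] a] h0(2)[OF module_hom_closed[OF L' a] i] by (simp only:)
  qed
qed

text \<open>
  Freeness of \<open>A\<close> enters through the lifting property alone. If \<open>I a \<subseteq> IB\<close> but \<open>a \<notin> B\<close>, some
  \<open>\<phi> : M \<rightarrow> I\<^sup>o\<close> is nonzero at the image of \<open>a\<close>. Its lift \<open>h : A \<rightarrow> E\<close> satisfies \<open>h(i b) = \<phi>(p b)(i) = 0\<close> for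
  \<open>b \<in> B\<close>, hence vanishes on \<open>IB\<close> and in particular on \<open>I a\<close>, which contradicts \<open>h(i a) = \<phi>(p a)(i)\<close>.
\<close>

lemma separated_imp_colon_eq:
  assumes "module R A" "module R M" "module R E" "ideal I R" "submodule B R A"
    and p: "p \<in> module_epi R A M" "\<And>a. a \<in> carrier A \<Longrightarrow> p a = \<zero>\<^bsub>M\<^esub> \<longleftrightarrow> a \<in> B"
    and lift: "\<And>\<phi>. \<phi> \<in> module_hom R A (Hom_module R (ideal_module R I) E) \<Longrightarrow>
      \<exists>h\<in>module_hom R A E. \<forall>a\<in>carrier A. \<forall>i\<in>I. h (i \<odot>\<^bsub>A\<^esub> a) = \<phi> a i"
    and sep: "\<And>x. \<lbrakk>x \<in> carrier M; x \<noteq> \<zero>\<^bsub>M\<^esub>\<rbrakk> \<Longrightarrow>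
      \<exists>\<phi>\<in>module_hom R M (Hom_module R (ideal_module R I) E).
        \<phi> x \<noteq> \<zero>\<^bsub>Hom_module R (ideal_module R I) E\<^esub>"
  shows "B = colon A (ideal_times A I B) I"
proof
  interpret A: module R A by fact
  interpret E: module R E by fact
  interpret I: ideal I R by fact
  interpret B: submodule B R A by fact
  have BA: "b \<in> carrier A" if "b \<in> B" for b using B.subset that by auto
  show "B \<subseteq> colon A (ideal_times A I B) I"
    by (auto simp: colon_def BA intro: ideal_times.prod)
  show "colon A (ideal_times A I B) I \<subseteq> B"
  proof
    fix a assume "a \<in> colon A (ideal_times A I B) I"
    then have a: "a \<in> carrier A" "\<And>i. i \<in> I \<Longrightarrow> i \<odot>\<^bsub>A\<^esub> a \<in> ideal_times A I B"
      by (auto simp: colon_def)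
    let ?I = "ideal_module R I"
    have H: "module R (Hom_module R ?I E)"
      by (rule module_Hom_module[OF module_ideal_module[OF A.R.is_cring assms(4)] assms(3)])
    have ph: "p \<in> module_hom R A M" using p(1) by (simp add: module_epi_def)
    show "a \<in> B"
    proof (rule ccontr)
      assume "a \<notin> B"
      then obtain \<phi> where \<phi>: "\<phi> \<in> module_hom R M (Hom_module R ?I E)"
        "\<phi> (p a) \<noteq> \<zero>\<^bsub>Hom_module R ?I E\<^esub>"
        using sep[OF module_hom_closed[OF ph a(1)]] p(2)[OF a(1)] by blast
      obtain h where h: "h \<in> module_hom R A E"
        "\<And>a i. \<lbrakk>a \<in> carrier A; i \<in> I\<rbrakk> \<Longrightarrow> h (i \<odot>\<^bsub>A\<^esub> a) = \<phi> (p a) i"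
        using lift[OF module_hom_comp[OF ph \<phi>(1)]] by blast
      have IB: "x \<in> carrier A \<and> h x = \<zero>\<^bsub>E\<^esub>" if "x \<in> ideal_times A I B" for x
        using that
      proof induction
        case (prod i b)
        have "\<phi> (p b) = \<zero>\<^bsub>Hom_module R ?I E\<^esub>"
          using p(2)[OF BA[OF prod(2)]] prod(2) module_hom_zero[OF assms(2) H \<phi>(1)] by simp
        then show ?case using h(2)[OF BA[OF prod(2)] prod(1)] prod BA I.Icarr by simp
      next
        case (sum x y)
        then show ?case using module_hom_add[OF h(1)] by simp
      qed
      have "\<phi> (p a) i = \<zero>\<^bsub>E\<^esub>" if "i \<in> I" for i
        using h(2)[OF a(1) that] IB[OF a(2)[OF that]] by simp
      then have "\<phi> (p a) = \<zero>\<^bsub>Hom_module R ?I E\<^esub>"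
        using Hom_valued_extensional[OF \<phi>(1) module_hom_closed[OF ph a(1)]]
        by (intro extensionalityI[of _ "carrier ?I"]) simp_all
      then show False using \<phi>(2) by simp
    qed
  qed
qed

text \<open>
  The free module \<open>A\<close> on the elements of \<open>M\<close> presents \<open>M\<close> as \<open>A/B\<close>, and \<open>C = A/IB\<close>. Elements of
  \<open>A\<close> are coefficient functions on \<open>M\<close>, whence the carrier type of \<open>C\<close>.
\<close>

lemma exists_quotient_by_annihilated_part:
  fixes R :: "('r, 'k) ring_scheme" and M :: "('r, 'm, 'b) module_scheme"
  assumes inj: "injective_module R E" and M: "module R M" and I: "ideal I R"
    and sep: "\<And>x. \<lbrakk>x \<in> carrier M; x \<noteq> \<zero>\<^bsub>M\<^esub>\<rbrakk> \<Longrightarrow>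
      \<exists>\<phi>\<in>module_hom R M (Hom_module R (ideal_module R I) E).
        \<phi> x \<noteq> \<zero>\<^bsub>Hom_module R (ideal_module R I) E\<^esub>"
  shows "\<exists>C :: ('r, ('m \<Rightarrow> 'r) set) module. module R C \<and>
    module_isomorphic R (quotient_module C (annihilated_part C I)) M"
proof -
  interpret M: module R M by (rule M)
  have E: "module R E" using inj by (simp add: injective_module_def)
  let ?F = "ideal_module R (carrier R)"
  let ?A = "direct_sum_copies (carrier M) ?F"
  interpret F: module R ?F by (rule module_ideal_module[OF M.R.is_cring M.R.oneideal])
  interpret A: module R ?A by (rule module_direct_sum_copies[OF F.module_axioms])
  let ?m = "\<lambda>x r. r \<odot>\<^bsub>M\<^esub> x"
  let ?p = "sum_of_maps (carrier M) ?F M ?m"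
  have m: "?m x \<in> module_hom R ?F M" if "x \<in> carrier M" for x
    using that by (intro module_homI) (simp_all add: M.smult_l_distr M.smult_assoc1)
  have p: "?p \<in> module_hom R ?A M" by (rule sum_of_maps_hom[OF F.module_axioms M m])
  have onto: "x \<in> ?p ` carrier ?A" if x: "x \<in> carrier M" for x
  proof
    let ?u = "sum_injection (carrier M) ?F x \<one>\<^bsub>R\<^esub>"
    show "?u \<in> carrier ?A"
      by (rule module_hom_closed[OF sum_injection_hom[OF F.module_axioms x]]) simp
    have "?p ?u = \<one>\<^bsub>R\<^esub> \<odot>\<^bsub>M\<^esub> x"
      by (rule sum_of_maps_injection[OF F.module_axioms M m x]) simp_all
    then show "x = ?p ?u" using x by simp
  qed
  have "?p ` carrier ?A = carrier M"
    using onto module_hom_closed[OF p] by blast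
  then have p_epi: "?p \<in> module_epi R ?A M" using p unfolding module_epi_def by blast
  let ?B = "{a \<in> carrier ?A. ?p a = \<zero>\<^bsub>M\<^esub>}"
  have B: "submodule ?B R ?A" by (rule kernel_submodule[OF A.module_axioms M p])
  have ker: "?p a = \<zero>\<^bsub>M\<^esub> \<longleftrightarrow> a \<in> ?B" if "a \<in> carrier ?A" for a using that by blast
  have lift: "\<exists>h\<in>module_hom R ?A E. \<forall>a\<in>carrier ?A. \<forall>i\<in>I. h (i \<odot>\<^bsub>?A\<^esub> a) = \<phi> a i"
    if "\<phi> \<in> module_hom R ?A (Hom_module R (ideal_module R I) E)" for \<phi>
    by (rule direct_sum_dual_lift[OF inj I that]) blast
  have "?B = colon ?A (ideal_times ?A I ?B) I"
    by (rule separated_imp_colon_eq[OF A.module_axioms M E I B p_epi ker lift sep])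
  from colon_eq_imp_quotient_by_annihilated_part[OF A.module_axioms M I B p_epi ker this]
  show ?thesis by blast
qed

section \<open>Equivalence of the conditions\<close>

theorem proposition3p1:
  fixes R :: "('r, 'k) ring_scheme" and \<mm> I :: "'r set"
    and E :: "('r, 'e, 'd) module_scheme"
    and M :: "('r, 'm, 'b) module_scheme"
  assumes "noetherian_local_ring R \<mm>"
    and "injective_hull R (residue_field R \<mm>) E"
    and "ideal I R"
    and "module R M"
  shows
    "(generated_by R (ideal_module R I) (matlis_dual R E M)
        \<longleftrightarrow> cogenerated_by R (matlis_dual R E (ideal_module R I)) M) \<and>
     (cogenerated_by R (matlis_dual R E (ideal_module R I)) M
        \<longleftrightarrow> (\<exists>C :: ('r, ('m \<Rightarrow> 'r) set) module. module R C \<and>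
              module_isomorphic R (quotient_module C (annihilated_part C I)) M)) \<and>
     (\<forall>\<Lambda> :: 'l set. generated_via R (ideal_module R I) (matlis_dual R E M) \<Lambda>
        \<longrightarrow> generated_by R (ideal_module R I) (matlis_dual R E M)) \<and>
     (\<forall>\<Lambda> :: 'n set. cogenerated_via R (matlis_dual R E (ideal_module R I)) M \<Lambda>
        \<longrightarrow> cogenerated_by R (matlis_dual R E (ideal_module R I)) M) \<and>
     (\<forall>C :: ('r, 'c, 'f) module_scheme. module R C \<and>
          module_isomorphic R (quotient_module C (annihilated_part C I)) M
        \<longrightarrow> cogenerated_by R (matlis_dual R E (ideal_module R I)) M) \<and>
     (\<forall>(A :: ('r, 'a, 'g) module_scheme) B.
        free_module R A \<and> submodule B R A \<and> module_isomorphic R M (quotient_module A B)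
        \<longrightarrow> (cogenerated_by R (matlis_dual R E (ideal_module R I)) M
              \<longleftrightarrow> B = colon A (ideal_times A I B) I))"
proof -
  let ?I = "ideal_module R I"
  interpret L: noetherian_local_ring R \<mm> by fact
  interpret I: ideal I R by fact
  interpret M: module R M by fact
  have inj: "injective_module R E" using assms(2) by (simp add: injective_hull_def)
  then have E: "module R E" by (simp add: injective_module_def)
  have IR: "module R ?I" by (rule module_ideal_module[OF L.is_cring assms(3)])
  let ?D = "Hom_module R ?I E"
  have D: "module R ?D" by (rule module_Hom_module[OF IR E])
  have MD: "module R (Hom_module R M E)" by (rule module_Hom_module[OF assms(4) E])
  define sep where "sep \<longleftrightarrow> (\<forall>x\<in>carrier M. x \<noteq> \<zero>\<^bsub>M\<^esub> \<longrightarrow>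
    (\<exists>\<phi>\<in>module_hom R M ?D. \<phi> x \<noteq> \<zero>\<^bsub>?D\<^esub>))"
  note cogenerator = residue_field_hull_cogenerates[OF assms(1,2)]

  have cog: "cogenerated_by R ?D M \<longleftrightarrow> sep"
    unfolding sep_def by (rule cogenerated_by_iff_separated[OF assms(4) D])
  have cog_via: "cogenerated_via R ?D M \<Lambda> \<Longrightarrow> sep" for \<Lambda> :: "'n set"
    unfolding sep_def using cogenerated_via_imp_separated[OF assms(4) D] by blast
  have gen: "generated_by R ?I (Hom_module R M E) \<longleftrightarrow>
      carrier (Hom_module R M E) \<subseteq> hom_trace R ?I (Hom_module R M E)"
    by (rule generated_by_iff_hom_trace[OF IR MD])
  have gen_via: "generated_via R ?I (Hom_module R M E) \<Lambda> \<Longrightarrow> generated_by R ?I (Hom_module R M E)"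
    for \<Lambda> :: "'l set"
    unfolding gen by (rule generated_via_imp_hom_trace[OF IR MD])

  have gen_sep: "carrier (Hom_module R M E) \<subseteq> hom_trace R ?I (Hom_module R M E) \<longleftrightarrow> sep"
  proof
    assume gen: "carrier (Hom_module R M E) \<subseteq> hom_trace R ?I (Hom_module R M E)"
    show sep
      unfolding sep_def
    proof (intro ballI impI)
      fix x assume x: "x \<in> carrier M" "x \<noteq> \<zero>\<^bsub>M\<^esub>"
      obtain f where "f \<in> module_hom R M E" "f x \<noteq> \<zero>\<^bsub>E\<^esub>" by (rule cogenerator[OF assms(4) x])
      then show "\<exists>\<phi>\<in>module_hom R M ?D. \<phi> x \<noteq> \<zero>\<^bsub>?D\<^esub>"
        by (rule dual_generated_imp_separated[OF assms(4) IR E gen x(1)])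
    qed
  next
    assume s: sep
    obtain K where K: "K \<subseteq> carrier R" "finite K" "I = genideal R K"
      using L.finetely_gen[OF assms(3)] by blast
    show "carrier (Hom_module R M E) \<subseteq> hom_trace R ?I (Hom_module R M E)"
    proof (rule separated_imp_dual_generated[OF inj assms(4) IR K(2)])
      show "K \<subseteq> carrier ?I" using L.genideal_self[OF K(1)] K(3) by simp
      show "g p = \<zero>\<^bsub>E\<^esub>"
        if "g \<in> module_hom R ?I E" "\<And>k. k \<in> K \<Longrightarrow> g k = \<zero>\<^bsub>E\<^esub>" "p \<in> carrier ?I" for g p
        using ideal_hom_determined_by_generators[OF K(1) E] that K(3) by simp
      show "\<exists>\<phi>\<in>module_hom R M ?D. \<phi> x \<noteq> \<zero>\<^bsub>?D\<^esub>" if "x \<in> carrier M" "x \<noteq> \<zero>\<^bsub>M\<^esub>" for x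
        using s[unfolded sep_def] that by blast
    qed
  qed

  have quot: "cogenerated_by R ?D M"
    if "module R C" "module_isomorphic R (quotient_module C (annihilated_part C I)) M"
    for C :: "('r, 'c, 'f) module_scheme"
    unfolding cog sep_def
    using isomorphic_quotient_by_annihilated_part_separated[OF assms that] by blast

  have exists_quot: "cogenerated_by R ?D M \<longleftrightarrow>
      (\<exists>C :: ('r, ('m \<Rightarrow> 'r) set) module. module R C \<and>
        module_isomorphic R (quotient_module C (annihilated_part C I)) M)"
  proof
    assume "cogenerated_by R ?D M"
    then have sep by (simp only: cog)
    then show "\<exists>C :: ('r, ('m \<Rightarrow> 'r) set) module. module R C \<and>
        module_isomorphic R (quotient_module C (annihilated_part C I)) M"
      unfolding sep_def by (intro exists_quotient_by_annihilated_part[OF inj assms(4,3)]) blast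
  next
    assume "\<exists>C :: ('r, ('m \<Rightarrow> 'r) set) module. module R C \<and>
        module_isomorphic R (quotient_module C (annihilated_part C I)) M"
    then show "cogenerated_by R ?D M"
      unfolding cog sep_def
      using isomorphic_quotient_by_annihilated_part_separated[OF assms] by blast
  qed

  have free: "cogenerated_by R ?D M \<longleftrightarrow> B = colon A (ideal_times A I B) I"
    if free: "free_module R A" and B: "submodule B R A"
      and iso: "module_isomorphic R M (quotient_module A B)"
    for A :: "('r, 'a, 'g) module_scheme" and B
  proof -
    have A: "module R A" using free by (simp add: free_module_def)
    have "module_isomorphic R (quotient_module A B) M"
      by (rule module_isomorphic_sym[OF assms(4) module_quotient_module[OF A B] iso])
    then obtain p where p: "p \<in> module_epi R A M"
      "\<And>a. a \<in> carrier A \<Longrightarrow> p a = \<zero>\<^bsub>M\<^esub> \<longleftrightarrow> a \<in> B"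
      using isomorphic_quotient_iff_epi[OF A assms(4) B] by blast
    show ?thesis
    proof
      assume "cogenerated_by R ?D M"
      then have s: sep by (simp only: cog)
      show "B = colon A (ideal_times A I B) I"
      proof (rule separated_imp_colon_eq[OF A assms(4) E assms(3) B p])
        show "\<exists>h\<in>module_hom R A E. \<forall>a\<in>carrier A. \<forall>i\<in>I. h (i \<odot>\<^bsub>A\<^esub> a) = \<phi> a i"
          if "\<phi> \<in> module_hom R A ?D" for \<phi>
          by (rule free_dual_lift[OF inj assms(3) free that]) blast
        show "\<exists>\<phi>\<in>module_hom R M ?D. \<phi> x \<noteq> \<zero>\<^bsub>?D\<^esub>" if "x \<in> carrier M" "x \<noteq> \<zero>\<^bsub>M\<^esub>" for x
          using s[unfolded sep_def] that by blast
      qed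
    next
      assume "B = colon A (ideal_times A I B) I"
      note C = colon_eq_imp_quotient_by_annihilated_part[OF A assms(4,3) B p this]
      show "cogenerated_by R ?D M"
        unfolding cog sep_def
        using isomorphic_quotient_by_annihilated_part_separated[OF assms C] by blast
    qed
  qed

  show ?thesis
    unfolding matlis_dual_def
  proof (intro conjI allI impI)
    show "generated_by R ?I (Hom_module R M E) \<longleftrightarrow> cogenerated_by R ?D M"
      by (simp only: gen gen_sep cog)
    show "cogenerated_by R ?D M \<longleftrightarrow>
      (\<exists>C :: ('r, ('m \<Rightarrow> 'r) set) module. module R C \<and>
        module_isomorphic R (quotient_module C (annihilated_part C I)) M)"
      by (rule exists_quot)
    show "generated_by R ?I (Hom_module R M E)"
      if "generated_via R ?I (Hom_module R M E) \<Lambda>" for \<Lambda> :: "'l set"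
      by (rule gen_via[OF that])
    show "cogenerated_by R ?D M" if "cogenerated_via R ?D M \<Lambda>" for \<Lambda> :: "'n set"
      using cog_via[OF that] by (simp only: cog)
    show "cogenerated_by R ?D M"
      if "module R C \<and> module_isomorphic R (quotient_module C (annihilated_part C I)) M"
      for C :: "('r, 'c, 'f) module_scheme"
      using that by (intro quot) blast+
    show "cogenerated_by R ?D M \<longleftrightarrow> B = colon A (ideal_times A I B) I"
      if "free_module R A \<and> submodule B R A \<and> module_isomorphic R M (quotient_module A B)"
      for A :: "('r, 'a, 'g) module_scheme" and B
      using that by (intro free) blast+
  qed
qed

end
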